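(* Let $\big((T\colon H\to B,\varphi_H),(L\colon A\to D,\varphi_A),f,h,g,l\big)$ be a strong projection of relative Rota-Baxter operators in $\mathsf{C}$ in which the Hopf algebras $H,B,A,D$ are all cocommutative. Then $$(I(q_A),I(q_D),\psi_{I(q_A)},\varphi_{I(q_A)},\psi_{I(q_D)},L_0)$$ is a left module over the relative Rota-Baxter operator $(T\colon H\to B,\varphi_H)$, where $L_0\colon I(q_A)\to I(q_D)$ is the unique morphism with $i_D\circ L_0=L\circ i_A$ and the actions are $$\psi_{I(q_A)}=p_A\circ\mu_A\circ(f\otimes i_A)\colon H\otimes I(q_A)\to I(q_A),$$ $$\varphi_{I(q_A)}=p_A\circ\varphi_A\circ(h\otimes i_A)\colon B\otimes I(q_A)\to I(q_A),$$ $$\psi_{I(q_D)}=p_D\circ\mu_D\circ(h\otimes i_D)\colon B\otimes I(q_D)\to I(q_D).$$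
   Context: $\mathsf{C}$ is a strict braided monoidal category in which idempotents split, with tensor product $\otimes$, unit object $K$ and braiding $c$. For an object $P$ and a morphism $f$, write $P\otimes f$ for $id_P\otimes f$ and $f\otimes P$ for $f\otimes id_P$. (Co)algebras, Hopf algebras and modules are taken in $\mathsf{C}$. A Hopf algebra is written $X=(X,\eta_X,\mu_X,\varepsilon_X,\delta_X,\lambda_X)$; it is cocommutative if $c_{X,X}\circ\delta_X=\delta_X$. Hopf algebra morphisms are algebra-coalgebra morphisms. Tensor products of algebras and coalgebras carry $\mu_{A\otimes B}=(\mu_A\otimes\mu_B)\circ(A\otimes c_{B,A}\otimes B)$ and $\delta_{D\otimes E}=(D\otimes c_{D,E}\otimes E)\circ(\delta_D\otimes\delta_E)$. The adjoint action of $X$ on itself is $\varphi_X^{ad}=\mu_X\circ(\mu_X\otimes\lambda_X)\circ(X\otimes c_{X,X})\circ(\delta_X\otimes X)$. For a Hopf algebra $X$ and an algebra-coalgebra $A$, $(A,\varphi_A)$ is a left $X$-module algebra-coalgebra if $(A,\varphi_A)$ is a left $X$-module, $\varphi_A\circ(X\otimes\eta_A)=\varepsilon_X\otimes\eta_A$, $\varphi_A\circ(X\otimes\mu_A)=\mu_A\circ(\varphi_A\otimes\varphi_A)\circ(X\otimes c_{X,A}\otimes A)\circ(\delta_X\otimes A\otimes A)$, and $\varphi_A\colon X\otimes A\to A$ is a coalgebra morphism. Relative Rota-Baxter operator $(T\colon H\to B,\varphi_H)$: $H$, $B$ are Hopf algebras, $(H,\varphi_H)$ is a left $B$-module algebra-coalgebra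 and $T\colon H\to B$ is a coalgebra morphism with $\mu_B\circ(T\otimes T)=T\circ\mu_H\circ(H\otimes(\varphi_H\circ(T\otimes H)))\circ(\delta_H\otimes H)$. A morphism $(T\colon H\to B,\varphi_H)\to(L\colon A\to D,\varphi_A)$ is a pair $(f,h)$ of Hopf algebra morphisms $f\colon H\to A$, $h\colon B\to D$ with $L\circ f=h\circ T$ and $f\circ\varphi_H=\varphi_A\circ(h\otimes f)$. A left module over $(T\colon H\to B,\varphi_H)$ is a 6-tuple $(M,N,\phi_M,\varphi_M,\varphi_N,\gamma)$ such that: (i) $(M,\phi_M)$ is a left $H$-module, $(M,\varphi_M)$ is a left $B$-module and $\varphi_M\circ(B\otimes\phi_M)=\phi_M\circ(\varphi_H\otimes\varphi_M)\circ(B\otimes c_{B,H}\otimes M)\circ(\delta_B\otimes H\otimes M)$; (ii) $(N,\varphi_N)$ is a left $B$-module; (iii) $\gamma\colon M\to N$ is a morphism in $\mathsf{C}$ with $\varphi_N\circ(T\otimes\gamma)=\gamma\circ\phi_M\circ(H\otimes(\varphi_M\circ(T\otimes M)))\circ(\delta_H\otimes M)$. A projection of Hopf algebras is $(X,Y,f,g)$ with $f\colon X\to Y$, $g\colon Y\to X$ Hopf algebra morphisms and $g\circ f=id_X$. Then $q_Y=\mu_Y\circ(Y\otimes(f\circ\lambda_X\circ g))\circ\delta_Y\colon Y\to Y$ is idempotent; write $q_Y=i_Y\circ p_Y$, $p_Y\circ i_Y=id_{I(q_Y)}$, with $p_Y\colon Y\to I(q_Y)$, $i_Y\colon I(q_Y)\to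 Y$. The morphism $i_Y$ is an equalizer of $(Y\otimes g)\circ\delta_Y$ and $Y\otimes\eta_X$. A projection of relative Rota-Baxter operators is a 6-tuple $((T\colon H\to B,\varphi_H),(L\colon A\to D,\varphi_A),f,h,g,l)$ such that $(H,A,f,g)$ and $(B,D,h,l)$ are projections of Hopf algebras, and $(f,h)\colon(T,\varphi_H)\to(L,\varphi_A)$ and $(g,l)\colon(L,\varphi_A)\to(T,\varphi_H)$ are morphisms of relative Rota-Baxter operators. Here $q_A,i_A,p_A,I(q_A)$ are associated to $(H,A,f,g)$ and $q_D,i_D,p_D,I(q_D)$ to $(B,D,h,l)$. (In the cocommutative case $L\circ i_A$ factors uniquely through $i_D$, so $L_0$ exists.) For $A$ cocommutative, $\overline{A}=(A,\eta_A,\overline{\mu}_A,\varepsilon_A,\delta_A,\overline{\lambda}_A)$ is the Hopf algebra with $\overline{\mu}_A=\mu_A\circ(A\otimes(\varphi_A\circ(L\otimes A)))\circ(\delta_A\otimes A)$ and $\overline{\lambda}_A=\varphi_A\circ((\lambda_D\circ L)\otimes\lambda_A)\circ\delta_A$. The projection is strong if $$p_A\circ\varphi_A=p_A\circ\varphi_A\circ(D\otimes q_A)\quad\text{and}\quad \varphi_{\overline{A}}^{ad}\circ(f\otimes i_A)=\mu_A\circ(\overline{\mu}_A\otimes\lambda_A)\circ(A\otimes c_{A,A})\circ((\delta_A\circ f)\otimes i_A).$$ *)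

theory Defs
  imports Main
begin

section \<open>Strict braided monoidal categories with split idempotents\<close>

text \<open>
  Objects and arrows are elements of two (arbitrary) types; only the elements of
  \<^term>\<open>Ob\<close> and \<^term>\<open>Ar\<close> are part of the category, and nothing is required of the
  operations outside of these sets. The tensor product of objects is written
  \<open>a \<odot> b\<close>, that of arrows \<open>f \<otimes> g\<close>. The braiding is \<open>\<c> a b\<close>, the unit
  object \<open>\<K>\<close>, and the identity of \<open>a\<close> is \<open>\<I> a\<close>.
\<close>

record ('o, 'm) braided_cat =
  Ob :: "'o set"
  Ar :: "'m set"
  Dom :: "'m \<Rightarrow> 'o"
  Cod :: "'m \<Rightarrow> 'o"
  Id :: "'o \<Rightarrow> 'm" ("\<I>\<index>")
  Comp :: "'m \<Rightarrow> 'm \<Rightarrow> 'm" (infixl "\<cdot>\<index>" 55)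
  Unit_ob :: "'o" ("\<K>\<index>")
  Tensor_ob :: "'o \<Rightarrow> 'o \<Rightarrow> 'o" (infixr "\<odot>\<index>" 70)
  Tensor :: "'m \<Rightarrow> 'm \<Rightarrow> 'm" (infixr "\<otimes>\<index>" 70)
  Braid :: "'o \<Rightarrow> 'o \<Rightarrow> 'm" ("\<c>\<index>")

definition Hom :: "('o, 'm) braided_cat \<Rightarrow> 'o \<Rightarrow> 'o \<Rightarrow> 'm set" where
  "Hom C a b = {f \<in> Ar C. Dom C f = a \<and> Cod C f = b}"

definition splitting :: "('o, 'm) braided_cat \<Rightarrow> 'm \<Rightarrow> 'o \<Rightarrow> 'o \<Rightarrow> 'm \<Rightarrow> 'm \<Rightarrow> bool" where
  "splitting C q a x p i \<longleftrightarrow>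
     x \<in> Ob C \<and> p \<in> Hom C a x \<and> i \<in> Hom C x a \<and>
     q = i \<cdot>\<^bsub>C\<^esub> p \<and> p \<cdot>\<^bsub>C\<^esub> i = \<I>\<^bsub>C\<^esub> x"

locale category =
  fixes C :: "('o, 'm) braided_cat" (structure)
  assumes Dom_Ob: "f \<in> Ar C \<Longrightarrow> Dom C f \<in> Ob C"
    and Cod_Ob: "f \<in> Ar C \<Longrightarrow> Cod C f \<in> Ob C"
    and Id_Hom: "a \<in> Ob C \<Longrightarrow> \<I> a \<in> Hom C a a"
    and Comp_Hom: "f \<in> Hom C a b \<Longrightarrow> g \<in> Hom C b d \<Longrightarrow> g \<cdot> f \<in> Hom C a d"
    and Comp_Id: "f \<in> Hom C a b \<Longrightarrow> f \<cdot> \<I> a = f"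
    and Id_Comp: "f \<in> Hom C a b \<Longrightarrow> \<I> b \<cdot> f = f"
    and Comp_assoc: "f \<in> Hom C a b \<Longrightarrow> g \<in> Hom C b d \<Longrightarrow> k \<in> Hom C d e \<Longrightarrow>
        (k \<cdot> g) \<cdot> f = k \<cdot> (g \<cdot> f)"

locale strict_monoidal_category = category +
  assumes Unit_Ob: "\<K> \<in> Ob C"
    and Tensor_Ob: "a \<in> Ob C \<Longrightarrow> b \<in> Ob C \<Longrightarrow> a \<odot> b \<in> Ob C"
    and Tensor_Hom: "f \<in> Hom C a b \<Longrightarrow> g \<in> Hom C a' b' \<Longrightarrow> f \<otimes> g \<in> Hom C (a \<odot> a') (b \<odot> b')"
    and Tensor_Id: "a \<in> Ob C \<Longrightarrow> b \<in> Ob C \<Longrightarrow> \<I> a \<otimes> \<I> b = \<I> (a \<odot> b)"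
    and Tensor_Comp: "f \<in> Hom C a b \<Longrightarrow> g \<in> Hom C b d \<Longrightarrow>
        f' \<in> Hom C a' b' \<Longrightarrow> g' \<in> Hom C b' d' \<Longrightarrow>
        (g \<cdot> f) \<otimes> (g' \<cdot> f') = (g \<otimes> g') \<cdot> (f \<otimes> f')"
    and Tensor_ob_assoc: "a \<in> Ob C \<Longrightarrow> b \<in> Ob C \<Longrightarrow> d \<in> Ob C \<Longrightarrow>
        (a \<odot> b) \<odot> d = a \<odot> (b \<odot> d)"
    and Unit_Tensor_ob: "a \<in> Ob C \<Longrightarrow> \<K> \<odot> a = a"
    and Tensor_ob_Unit: "a \<in> Ob C \<Longrightarrow> a \<odot> \<K> = a"
    and Tensor_assoc: "f \<in> Ar C \<Longrightarrow> g \<in> Ar C \<Longrightarrow> k \<in> Ar C \<Longrightarrow>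
        (f \<otimes> g) \<otimes> k = f \<otimes> (g \<otimes> k)"
    and Unit_Tensor: "f \<in> Ar C \<Longrightarrow> \<I> \<K> \<otimes> f = f"
    and Tensor_Unit: "f \<in> Ar C \<Longrightarrow> f \<otimes> \<I> \<K> = f"

locale strict_braided_category = strict_monoidal_category +
  assumes Braid_Hom: "a \<in> Ob C \<Longrightarrow> b \<in> Ob C \<Longrightarrow> \<c> a b \<in> Hom C (a \<odot> b) (b \<odot> a)"
    and Braid_iso: "a \<in> Ob C \<Longrightarrow> b \<in> Ob C \<Longrightarrow>
        \<exists>k \<in> Hom C (b \<odot> a) (a \<odot> b). k \<cdot> \<c> a b = \<I> (a \<odot> b) \<and> \<c> a b \<cdot> k = \<I> (b \<odot> a)"
    and Braid_natural: "f \<in> Hom C a a' \<Longrightarrow> g \<in> Hom C b b' \<Longrightarrow>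
        \<c> a' b' \<cdot> (f \<otimes> g) = (g \<otimes> f) \<cdot> \<c> a b"
    and Braid_Tensor_right: "a \<in> Ob C \<Longrightarrow> b \<in> Ob C \<Longrightarrow> d \<in> Ob C \<Longrightarrow>
        \<c> a (b \<odot> d) = (\<I> b \<otimes> \<c> a d) \<cdot> (\<c> a b \<otimes> \<I> d)"
    and Braid_Tensor_left: "a \<in> Ob C \<Longrightarrow> b \<in> Ob C \<Longrightarrow> d \<in> Ob C \<Longrightarrow>
        \<c> (a \<odot> b) d = (\<c> a d \<otimes> \<I> b) \<cdot> (\<I> a \<otimes> \<c> b d)"

locale split_strict_braided_category = strict_braided_category +
  assumes idempotents_split: "e \<in> Hom C a a \<Longrightarrow> e \<cdot> e = e \<Longrightarrow> \<exists>x p i. splitting C e a x p i"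


section \<open>Algebras, coalgebras, Hopf algebras\<close>

text \<open>
  An object together with (candidates for) an algebra and a coalgebra structure,
  with no compatibility between the two; \<open>lam\<close> below is the antipode.
\<close>

record ('o, 'm) alg_coalg =
  obj :: "'o"
  eta :: "'m"
  mu :: "'m"
  eps :: "'m"
  delta :: "'m"

record ('o, 'm) hopf = "('o, 'm) alg_coalg" +
  lam :: "'m"

context
  fixes C :: "('o, 'm) braided_cat" (structure)
begin

definition algebra :: "('o, 'm, 'z) alg_coalg_scheme \<Rightarrow> bool" where
  "algebra X \<longleftrightarrow>
     obj X \<in> Ob C \<and>
     eta X \<in> Hom C \<K> (obj X) \<and> mu X \<in> Hom C (obj X \<odot> obj X) (obj X) \<and>
     mu X \<cdot> (eta X \<otimes> \<I> (obj X)) = \<I> (obj X) \<and>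
     mu X \<cdot> (\<I> (obj X) \<otimes> eta X) = \<I> (obj X) \<and>
     mu X \<cdot> (mu X \<otimes> \<I> (obj X)) = mu X \<cdot> (\<I> (obj X) \<otimes> mu X)"

definition coalgebra :: "('o, 'm, 'z) alg_coalg_scheme \<Rightarrow> bool" where
  "coalgebra X \<longleftrightarrow>
     obj X \<in> Ob C \<and>
     eps X \<in> Hom C (obj X) \<K> \<and> delta X \<in> Hom C (obj X) (obj X \<odot> obj X) \<and>
     (eps X \<otimes> \<I> (obj X)) \<cdot> delta X = \<I> (obj X) \<and>
     (\<I> (obj X) \<otimes> eps X) \<cdot> delta X = \<I> (obj X) \<and>
     (delta X \<otimes> \<I> (obj X)) \<cdot> delta X = (\<I> (obj X) \<otimes> delta X) \<cdot> delta X"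

definition alg_mor ::
    "('o, 'm, 'y) alg_coalg_scheme \<Rightarrow> ('o, 'm, 'z) alg_coalg_scheme \<Rightarrow> 'm \<Rightarrow> bool" where
  "alg_mor X Y f \<longleftrightarrow>
     f \<in> Hom C (obj X) (obj Y) \<and>
     f \<cdot> eta X = eta Y \<and> f \<cdot> mu X = mu Y \<cdot> (f \<otimes> f)"

definition coalg_mor ::
    "('o, 'm, 'y) alg_coalg_scheme \<Rightarrow> ('o, 'm, 'z) alg_coalg_scheme \<Rightarrow> 'm \<Rightarrow> bool" where
  "coalg_mor X Y f \<longleftrightarrow>
     f \<in> Hom C (obj X) (obj Y) \<and>
     eps Y \<cdot> f = eps X \<and> delta Y \<cdot> f = (f \<otimes> f) \<cdot> delta X"

text \<open>The unit object and the tensor product, with their algebra and coalgebra structures.\<close>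

definition unit_ac :: "('o, 'm) alg_coalg" where
  "unit_ac = \<lparr>obj = \<K>, eta = \<I> \<K>, mu = \<I> \<K>, eps = \<I> \<K>, delta = \<I> \<K>\<rparr>"

definition tensor_ac ::
    "('o, 'm, 'y) alg_coalg_scheme \<Rightarrow> ('o, 'm, 'z) alg_coalg_scheme \<Rightarrow> ('o, 'm) alg_coalg" where
  "tensor_ac X Y =
     \<lparr>obj = obj X \<odot> obj Y,
      eta = eta X \<otimes> eta Y,
      mu = (mu X \<otimes> mu Y) \<cdot> (\<I> (obj X) \<otimes> \<c> (obj Y) (obj X) \<otimes> \<I> (obj Y)),
      eps = eps X \<otimes> eps Y,
      delta = (\<I> (obj X) \<otimes> \<c> (obj X) (obj Y) \<otimes> \<I> (obj Y)) \<cdot> (delta X \<otimes> delta Y)\<rparr>"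

definition hopf_algebra :: "('o, 'm) hopf \<Rightarrow> bool" where
  "hopf_algebra X \<longleftrightarrow>
     algebra X \<and> coalgebra X \<and>
     alg_mor X unit_ac (eps X) \<and> alg_mor X (tensor_ac X X) (delta X) \<and>
     lam X \<in> Hom C (obj X) (obj X) \<and>
     mu X \<cdot> (lam X \<otimes> \<I> (obj X)) \<cdot> delta X = eta X \<cdot> eps X \<and>
     mu X \<cdot> (\<I> (obj X) \<otimes> lam X) \<cdot> delta X = eta X \<cdot> eps X"

definition hopf_mor :: "('o, 'm) hopf \<Rightarrow> ('o, 'm) hopf \<Rightarrow> 'm \<Rightarrow> bool" where
  "hopf_mor X Y f \<longleftrightarrow> alg_mor X Y f \<and> coalg_mor X Y f"

definition cocommutative :: "('o, 'm) hopf \<Rightarrow> bool" where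
  "cocommutative X \<longleftrightarrow> \<c> (obj X) (obj X) \<cdot> delta X = delta X"

definition adjoint_action :: "('o, 'm) hopf \<Rightarrow> 'm" where
  "adjoint_action X =
     mu X \<cdot> (mu X \<otimes> lam X) \<cdot> (\<I> (obj X) \<otimes> \<c> (obj X) (obj X)) \<cdot> (delta X \<otimes> \<I> (obj X))"

definition left_module :: "('o, 'm, 'z) alg_coalg_scheme \<Rightarrow> 'o \<Rightarrow> 'm \<Rightarrow> bool" where
  "left_module X M \<phi> \<longleftrightarrow>
     M \<in> Ob C \<and> \<phi> \<in> Hom C (obj X \<odot> M) M \<and>
     \<phi> \<cdot> (eta X \<otimes> \<I> M) = \<I> M \<and>
     \<phi> \<cdot> (\<I> (obj X) \<otimes> \<phi>) = \<phi> \<cdot> (mu X \<otimes> \<I> M)"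

definition module_alg_coalg ::
    "('o, 'm) hopf \<Rightarrow> ('o, 'm, 'z) alg_coalg_scheme \<Rightarrow> 'm \<Rightarrow> bool" where
  "module_alg_coalg X A \<phi> \<longleftrightarrow>
     hopf_algebra X \<and> algebra A \<and> coalgebra A \<and>
     left_module X (obj A) \<phi> \<and>
     \<phi> \<cdot> (\<I> (obj X) \<otimes> eta A) = eps X \<otimes> eta A \<and>
     \<phi> \<cdot> (\<I> (obj X) \<otimes> mu A) =
       mu A \<cdot> (\<phi> \<otimes> \<phi>) \<cdot> (\<I> (obj X) \<otimes> \<c> (obj X) (obj A) \<otimes> \<I> (obj A))
         \<cdot> (delta X \<otimes> \<I> (obj A) \<otimes> \<I> (obj A)) \<and>
     coalg_mor (tensor_ac X A) A \<phi>"

end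


section \<open>Relative Rota-Baxter operators, their modules and projections\<close>

context
  fixes C :: "('o, 'm) braided_cat" (structure)
begin

definition rel_rota_baxter :: "('o, 'm) hopf \<Rightarrow> ('o, 'm) hopf \<Rightarrow> 'm \<Rightarrow> 'm \<Rightarrow> bool" where
  "rel_rota_baxter H B T \<phi>H \<longleftrightarrow>
     hopf_algebra C H \<and> hopf_algebra C B \<and>
     module_alg_coalg C B H \<phi>H \<and> coalg_mor C H B T \<and>
     mu B \<cdot> (T \<otimes> T) =
       T \<cdot> mu H \<cdot> (\<I> (obj H) \<otimes> (\<phi>H \<cdot> (T \<otimes> \<I> (obj H)))) \<cdot> (delta H \<otimes> \<I> (obj H))"

text \<open>
  \<open>rrb_mor H B T \<phi>H A D L \<phi>A f h\<close>: \<open>(f, h)\<close> is a morphism from \<open>(T : H \<rightarrow> B, \<phi>H)\<close> to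
  \<open>(L : A \<rightarrow> D, \<phi>A)\<close>.
\<close>

definition rrb_mor ::
    "('o, 'm) hopf \<Rightarrow> ('o, 'm) hopf \<Rightarrow> 'm \<Rightarrow> 'm \<Rightarrow>
     ('o, 'm) hopf \<Rightarrow> ('o, 'm) hopf \<Rightarrow> 'm \<Rightarrow> 'm \<Rightarrow> 'm \<Rightarrow> 'm \<Rightarrow> bool" where
  "rrb_mor H B T \<phi>H A D L \<phi>A f h \<longleftrightarrow>
     rel_rota_baxter H B T \<phi>H \<and> rel_rota_baxter A D L \<phi>A \<and>
     hopf_mor C H A f \<and> hopf_mor C B D h \<and>
     L \<cdot> f = h \<cdot> T \<and> f \<cdot> \<phi>H = \<phi>A \<cdot> (h \<otimes> f)"

definition rrb_module ::
    "('o, 'm) hopf \<Rightarrow> ('o, 'm) hopf \<Rightarrow> 'm \<Rightarrow> 'm \<Rightarrow>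
     'o \<times> 'o \<times> 'm \<times> 'm \<times> 'm \<times> 'm \<Rightarrow> bool" where
  "rrb_module H B T \<phi>H = (\<lambda>(M, N, \<psi>M, \<phi>M, \<phi>N, \<gamma>).
     left_module C H M \<psi>M \<and> left_module C B M \<phi>M \<and>
     \<phi>M \<cdot> (\<I> (obj B) \<otimes> \<psi>M) =
       \<psi>M \<cdot> (\<phi>H \<otimes> \<phi>M) \<cdot> (\<I> (obj B) \<otimes> \<c> (obj B) (obj H) \<otimes> \<I> M)
         \<cdot> (delta B \<otimes> \<I> (obj H) \<otimes> \<I> M) \<and>
     left_module C B N \<phi>N \<and>
     \<gamma> \<in> Hom C M N \<and>
     \<phi>N \<cdot> (T \<otimes> \<gamma>) =
       \<gamma> \<cdot> \<psi>M \<cdot> (\<I> (obj H) \<otimes> (\<phi>M \<cdot> (T \<otimes> \<I> M))) \<cdot> (delta H \<otimes> \<I> M))"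

definition hopf_projection :: "('o, 'm) hopf \<Rightarrow> ('o, 'm) hopf \<Rightarrow> 'm \<Rightarrow> 'm \<Rightarrow> bool" where
  "hopf_projection X Y f g \<longleftrightarrow>
     hopf_algebra C X \<and> hopf_algebra C Y \<and>
     hopf_mor C X Y f \<and> hopf_mor C Y X g \<and> g \<cdot> f = \<I> (obj X)"

definition proj_idem :: "('o, 'm) hopf \<Rightarrow> ('o, 'm) hopf \<Rightarrow> 'm \<Rightarrow> 'm \<Rightarrow> 'm" where
  "proj_idem X Y f g = mu Y \<cdot> (\<I> (obj Y) \<otimes> (f \<cdot> lam X \<cdot> g)) \<cdot> delta Y"

definition rrb_projection ::
    "('o, 'm) hopf \<Rightarrow> ('o, 'm) hopf \<Rightarrow> 'm \<Rightarrow> 'm \<Rightarrow>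
     ('o, 'm) hopf \<Rightarrow> ('o, 'm) hopf \<Rightarrow> 'm \<Rightarrow> 'm \<Rightarrow>
     'm \<Rightarrow> 'm \<Rightarrow> 'm \<Rightarrow> 'm \<Rightarrow> bool" where
  "rrb_projection H B T \<phi>H A D L \<phi>A f h g l \<longleftrightarrow>
     hopf_projection H A f g \<and> hopf_projection B D h l \<and>
     rrb_mor H B T \<phi>H A D L \<phi>A f h \<and> rrb_mor A D L \<phi>A H B T \<phi>H g l"

text \<open>
  The structure \<open>\<overline>A\<close> on the object of \<open>A\<close> induced by \<open>(L : A \<rightarrow> D, \<phi>A)\<close>: unit, counit
  and coproduct are those of \<open>A\<close>.
\<close>

definition bar :: "('o, 'm) hopf \<Rightarrow> ('o, 'm) hopf \<Rightarrow> 'm \<Rightarrow> 'm \<Rightarrow> ('o, 'm) hopf" where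
  "bar A D L \<phi>A = A
     \<lparr>mu := mu A \<cdot> (\<I> (obj A) \<otimes> (\<phi>A \<cdot> (L \<otimes> \<I> (obj A)))) \<cdot> (delta A \<otimes> \<I> (obj A)),
      lam := \<phi>A \<cdot> ((lam D \<cdot> L) \<otimes> lam A) \<cdot> delta A\<rparr>"

text \<open>
  The arrows \<open>pA\<close>, \<open>iA\<close> are meant to be those of a splitting of the idempotent
  \<open>proj_idem H A f g\<close>.
\<close>

definition strong_rrb_projection ::
    "('o, 'm) hopf \<Rightarrow> ('o, 'm) hopf \<Rightarrow> 'm \<Rightarrow> 'm \<Rightarrow>
     ('o, 'm) hopf \<Rightarrow> ('o, 'm) hopf \<Rightarrow> 'm \<Rightarrow> 'm \<Rightarrow>
     'm \<Rightarrow> 'm \<Rightarrow> 'm \<Rightarrow> 'm \<Rightarrow> 'm \<Rightarrow> 'm \<Rightarrow> bool" where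
  "strong_rrb_projection H B T \<phi>H A D L \<phi>A f h g l pA iA \<longleftrightarrow>
     rrb_projection H B T \<phi>H A D L \<phi>A f h g l \<and>
     pA \<cdot> \<phi>A = pA \<cdot> \<phi>A \<cdot> (\<I> (obj D) \<otimes> proj_idem H A f g) \<and>
     adjoint_action C (bar A D L \<phi>A) \<cdot> (f \<otimes> iA) =
       mu A \<cdot> (mu (bar A D L \<phi>A) \<otimes> lam A) \<cdot> (\<I> (obj A) \<otimes> \<c> (obj A) (obj A))
         \<cdot> ((delta A \<cdot> f) \<otimes> iA)"

end

end

theory Submission
  imports Defs
begin

text \<open>
  Written with group elements, the object \<open>I(q_A)\<close> is the kernel of \<open>g\<close>, and
  \<open>q_A(a) = a \<cdot> f(g(a))\<^sup>-\<^sup>1\<close>. The module laws hold because \<open>p_A\<close> absorbs \<open>q_A\<close> in the arguments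
  of the actions: \<open>p_A \<mu>_A (f \<otimes> q_A) = p_A \<mu>_A (f \<otimes> A)\<close> holds for every projection of Hopf algebras,
  and the first strongness condition is the analogue for \<open>\<phi>_A\<close>.
  For the compatibility of \<open>L_0\<close> with the actions let \<open>z = f(x) * m\<close> with \<open>m\<close> in \<open>I(q_A)\<close>, where \<open>*\<close>
  is the product of \<open>bar A\<close>. As \<open>g(z) = x\<close> and \<open>L\<close> is multiplicative on \<open>bar A\<close>,
  \<open>q_D(L z) = L(z) \<cdot> L(f x)\<^sup>-\<^sup>1 = L(f(x) * m * f(x)\<^sup>-\<^sup>1)\<close>, the inverse being taken in \<open>bar A\<close>. By
  the second strongness condition the argument of \<open>L\<close> is \<open>z \<cdot> f(x)\<^sup>-\<^sup>1 = q_A(z)\<close>, so \<open>q_D L = L q_A\<close>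
  on such elements, which is the required identity after composition with \<open>i_D\<close>.
  Cocommutativity of \<open>A\<close> enters only in the compatibility of \<open>*\<close> with the coproduct.
\<close>

section \<open>String diagrams\<close>

text \<open>The overview argues with elements, which a braided category does not have. Copies are
  made by the coproduct, so the remark g(z) = x turns into \<open>delta_mubar_fi\<close>, a
  statement about a coproduct one leg of which is sent through \<open>g\<close>. Inverses become
  inverses for convolution, and their uniqueness becomes \<open>conv_cancel_right\<close>, from
  which \<open>hopf_mor_lam\<close>, \<open>q_mu_f\<close>, \<open>delta_q\<close> and
  \<open>L_lambar\<close> are derived. The braiding need not be symmetric: strands cannot be
  permuted freely and every crossing has to be carried along, which makes composing arrows by hand
  impractical and is the reason for the diagram calculus. Its rewriting proves an equation by
  normalising both sides. Hence a fact that has to be used against the direction of rewriting, or at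
  a place that the normal form hides, appears in the proofs as an explicit intermediate
  composite.\<close>

text \<open>
  A state \<open>(xs, m)\<close> is an arrow \<open>m\<close> whose codomain is the tensor product of the list \<open>xs\<close> of
  strands. \<open>layer C n xs f ys\<close> composes it with \<open>id \<otimes> f \<otimes> id\<close>, where \<open>f\<close> acts on the strands \<open>xs\<close>
  starting at position \<open>n\<close>. A diagram is thus a nested application of layers, in which equations
  between arrows become local rewrite rules, and strict associativity is hidden in the lists.
\<close>

fun ten :: "('o, 'm) braided_cat \<Rightarrow> 'o list \<Rightarrow> 'o" where
  "ten C [] = Unit_ob C"
| "ten C [x] = x"
| "ten C (x # y # zs) = Tensor_ob C x (ten C (y # zs))"

definition gen :: "('o, 'm) braided_cat \<Rightarrow> 'o list \<Rightarrow> 'm \<Rightarrow> 'o list \<Rightarrow> bool" where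
  "gen C xs f ys \<longleftrightarrow> set xs \<subseteq> Ob C \<and> set ys \<subseteq> Ob C \<and> f \<in> Hom C (ten C xs) (ten C ys)"

definition ok :: "('o, 'm) braided_cat \<Rightarrow> 'o list \<times> 'm \<Rightarrow> bool" where
  "ok C s \<longleftrightarrow> set (fst s) \<subseteq> Ob C \<and> snd s \<in> Ar C \<and> Cod C (snd s) = ten C (fst s)"

text \<open>The bound on \<open>n\<close> matters for \<open>xs = []\<close>, the source of a unit:
  the condition on \<open>take\<close> is then vacuous and would admit any position.\<close>

definition fits :: "('o, 'm) braided_cat \<Rightarrow> nat \<Rightarrow> 'o list \<Rightarrow> 'o list \<times> 'm \<Rightarrow> bool" where
  "fits C n xs s \<longleftrightarrow> ok C s \<and> n \<le> length (fst s) \<and> take (length xs) (drop n (fst s)) = xs"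

definition layer :: "('o, 'm) braided_cat \<Rightarrow> nat \<Rightarrow> 'o list \<Rightarrow> 'm \<Rightarrow> 'o list \<Rightarrow>
    'o list \<times> 'm \<Rightarrow> 'o list \<times> 'm" where
  "layer C n xs f ys s =
    (let ls = take n (fst s); rs = drop (n + length xs) (fst s) in
     (ls @ ys @ rs, Comp C (Tensor C (Id C (ten C ls)) (Tensor C f (Id C (ten C rs)))) (snd s)))"

fun run :: "('o, 'm) braided_cat \<Rightarrow> nat \<Rightarrow> (nat \<times> 'o list \<times> 'm \<times> 'o list) list \<Rightarrow>
    'o list \<times> 'm \<Rightarrow> 'o list \<times> 'm" where
  "run C k [] s = s"
| "run C k ((n, xs, f, ys) # d) s = run C k d (layer C (k + n) xs f ys s)"

definition shift :: "nat \<Rightarrow> (nat \<times> 'o list \<times> 'm \<times> 'o list) list \<Rightarrow> (nat \<times> 'o list \<times> 'm \<times> 'o list)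
    list" where
  "shift k = map (\<lambda>(n, t). (k + n, t))"

definition start :: "('o, 'm) braided_cat \<Rightarrow> 'o list \<Rightarrow> 'o list \<times> 'm" where
  "start C xs = (xs, Id C (ten C xs))"

text \<open>Agreement with \<open>E\<close> is demanded in every context \<open>ls\<close>,
  \<open>rs\<close> and after every incoming arrow \<open>m\<close>. This lets the relation pass
  through tensor products, and it turns an equation of arrows into a rewrite rule for a part of a
  state.\<close>

definition denotes :: "('o, 'm) braided_cat \<Rightarrow> 'o list \<Rightarrow> 'm \<Rightarrow> 'o list \<Rightarrow>
    (nat \<times> 'o list \<times> 'm \<times> 'o list) list \<Rightarrow> bool" where
  "denotes C xs E ys d \<longleftrightarrow> gen C xs E ys \<and>
     (\<forall>ls rs m. ok C (ls @ xs @ rs, m) \<longrightarrow>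
        run C (length ls) d (ls @ xs @ rs, m) = layer C (length ls) xs E ys (ls @ xs @ rs, m))"

lemma run_append: "run C k (d @ e) s = run C k e (run C k d s)"
  by (induction C k d s rule: run.induct) simp_all

lemma run_shift: "run C k (shift j d) s = run C (k + j) d s"
  by (induction C "k + j" d s rule: run.induct) (simp_all add: shift_def add.assoc)

lemma shift_simps [simp]: "shift k [] = []" "shift k ((n, t) # d) = (k + n, t) # shift k d"
  by (auto simp: shift_def)

lemma layer_append: "k = length ls \<Longrightarrow> layer C k xs f ys (ls @ xs @ rs, m) =
    (ls @ ys @ rs, Comp C (Tensor C (Id C (ten C ls)) (Tensor C f (Id C (ten C rs)))) m)"
  by (simp add: layer_def)

lemma fst_layer [simp]: "fst (layer C n xs f ys s) = take n (fst s) @ ys @ drop (n + length xs)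
    (fst s)"
  by (simp add: layer_def Let_def)

lemma fitsE:
  assumes "fits C n xs s"
  obtains ls rs m where "s = (ls @ xs @ rs, m)" "length ls = n" "ok C (ls @ xs @ rs, m)"
proof -
  obtain us m where s: "s = (us, m)" by force
  have "us = take n us @ drop n us" by simp
  also have "drop n us = xs @ drop (length xs) (drop n us)"
    using assms unfolding fits_def s by (metis append_take_drop_id fst_conv)
  finally show thesis
    using that[of "take n us" "drop (length xs) (drop n us)" m] assms unfolding fits_def s by simp
qed

section \<open>Soundness of diagrams in a strict monoidal category\<close>

context category
begin

lemma HomD: "f \<in> Hom C a b \<Longrightarrow> f \<in> Ar C \<and> Dom C f = a \<and> Cod C f = b \<and> a \<in> Ob C \<and> b \<in> Ob C"
  using Dom_Ob Cod_Ob by (auto simp: Hom_def)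

lemma Ar_Hom: "f \<in> Ar C \<Longrightarrow> f \<in> Hom C (Dom C f) (Cod C f)"
  by (auto simp: Hom_def)

end

context strict_monoidal_category
begin

abbreviation "tn \<equiv> ten C"

lemma ten_Ob [simp]: "set xs \<subseteq> Ob C \<Longrightarrow> tn xs \<in> Ob C"
proof (induction xs)
  case (Cons x xs)
  then show ?case by (cases xs) (auto simp: Tensor_Ob)
qed (simp add: Unit_Ob)

text \<open>\<open>ten\<close> treats singletons separately because \<open>x \<odot> \<K>\<close>
  equals \<open>x\<close> only for objects of \<open>C\<close>; the strict unit law recovers the
  uniform recursion.\<close>

lemma ten_Cons: "x \<in> Ob C \<Longrightarrow> tn (x # xs) = x \<odot> tn xs"
  by (cases xs) (auto simp: Tensor_ob_Unit)

lemma ten_append: "set xs \<subseteq> Ob C \<Longrightarrow> set ys \<subseteq> Ob C \<Longrightarrow> tn (xs @ ys) = tn xs \<odot> tn ys"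
  by (induction xs) (auto simp: Unit_Tensor_ob ten_Cons Tensor_ob_assoc simp del: ten.simps(3))

lemma Id_ten_append: "set xs \<subseteq> Ob C \<Longrightarrow> set ys \<subseteq> Ob C \<Longrightarrow> \<I> (tn (xs @ ys)) = \<I> (tn xs) \<otimes> \<I> (tn ys)"
  by (simp add: ten_append Tensor_Id)

lemma whisker_Hom:
  assumes "gen C xs f ys" "set ls \<subseteq> Ob C" "set rs \<subseteq> Ob C"
  shows "\<I> (tn ls) \<otimes> f \<otimes> \<I> (tn rs) \<in> Hom C (tn (ls @ xs @ rs)) (tn (ls @ ys @ rs))"
  using assms by (simp add: gen_def ten_append Tensor_Hom Id_Hom)

lemma genD: "gen C xs f ys \<Longrightarrow> set xs \<subseteq> Ob C \<and> set ys \<subseteq> Ob C \<and> f \<in> Hom C (tn xs) (tn ys)"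
  by (simp add: gen_def)

lemma okD: "ok C (xs, m) \<Longrightarrow> set xs \<subseteq> Ob C \<and> m \<in> Hom C (Dom C m) (tn xs)"
  by (simp add: ok_def Hom_def)

lemma okI: "set xs \<subseteq> Ob C \<Longrightarrow> m \<in> Hom C a (tn xs) \<Longrightarrow> ok C (xs, m)"
  by (simp add: ok_def Hom_def)

lemma layer_ok_append:
  assumes "gen C xs f ys" "ok C (ls @ xs @ rs, m)" "k = length ls"
  shows "ok C (layer C k xs f ys (ls @ xs @ rs, m))"
proof -
  have "m \<in> Hom C (Dom C m) (tn (ls @ xs @ rs))" "set ls \<subseteq> Ob C" "set rs \<subseteq> Ob C" "set ys \<subseteq> Ob C"
    using assms okD genD by fastforce+
  then show ?thesis
    using Comp_Hom[OF _ whisker_Hom[OF assms(1), of ls rs], of m] assms(3) okD[OF assms(2)]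
    by (subst layer_append[OF assms(3)], intro okI) auto
qed

lemma ok_layer [simp]: "fits C n xs s \<Longrightarrow> gen C xs f ys \<Longrightarrow> ok C (layer C n xs f ys s)"
  by (metis fitsE layer_ok_append)

lemma ok_start [simp]: "set xs \<subseteq> Ob C \<Longrightarrow> ok C (start C xs)"
  unfolding start_def by (rule okI) (auto intro: Id_Hom)

lemma denotes_gen: "gen C xs f ys \<Longrightarrow> denotes C xs f ys [(0, xs, f, ys)]"
  by (simp add: denotes_def)

lemma denotes_Id: "set xs \<subseteq> Ob C \<Longrightarrow> a = tn xs \<Longrightarrow> denotes C xs (\<I> a) xs []"
  unfolding denotes_def gen_def
proof (intro conjI allI impI)
  fix ls rs m
  assume xs: "set xs \<subseteq> Ob C" "a = tn xs" and ok: "ok C (ls @ xs @ rs, m)"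
  have "set ls \<subseteq> Ob C" "set rs \<subseteq> Ob C" using okD[OF ok] by auto
  then have "\<I> (tn ls) \<otimes> \<I> (tn xs) \<otimes> \<I> (tn rs) = \<I> (tn (ls @ xs @ rs))"
    using xs by (simp add: ten_append Tensor_Id Tensor_Ob)
  then show "run C (length ls) [] (ls @ xs @ rs, m) = layer C (length ls) xs (\<I> a) xs (ls @ xs @
      rs, m)"
    using xs Id_Comp okD[OF ok] by (metis layer_append run.simps(1))
qed (auto intro: Id_Hom)

lemma whisker_Comp:
  assumes "gen C xs f ys" "gen C ys g zs" "set ls \<subseteq> Ob C" "set rs \<subseteq> Ob C"
  shows "\<I> (tn ls) \<otimes> (g \<cdot> f) \<otimes> \<I> (tn rs) =
    (\<I> (tn ls) \<otimes> g \<otimes> \<I> (tn rs)) \<cdot> (\<I> (tn ls) \<otimes> f \<otimes> \<I> (tn rs))"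
proof -
  have I: "\<I> (tn ls) \<in> Hom C (tn ls) (tn ls)" "\<I> (tn rs) \<in> Hom C (tn rs) (tn rs)"
    using assms by (auto intro: Id_Hom)
  have "(g \<cdot> f) \<otimes> \<I> (tn rs) = (g \<otimes> \<I> (tn rs)) \<cdot> (f \<otimes> \<I> (tn rs))"
    using Tensor_Comp[of f _ _ g _ "\<I> (tn rs)" _ _ "\<I> (tn rs)"] I assms genD by (metis Id_Comp)
  then show ?thesis
    using Tensor_Comp[OF I(1) I(1) Tensor_Hom[OF _ I(2)] Tensor_Hom[OF _ I(2)], of f _ _ g] I
        assms genD
    by (metis Id_Comp)
qed

lemma layer_Comp:
  assumes "gen C xs f ys" "gen C ys g zs" "ok C (ls @ xs @ rs, m)"
  shows "layer C (length ls) xs (g \<cdot> f) zs (ls @ xs @ rs, m) =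
    layer C (length ls) ys g zs (layer C (length ls) xs f ys (ls @ xs @ rs, m))"
proof -
  have o: "set ls \<subseteq> Ob C" "set rs \<subseteq> Ob C" "m \<in> Hom C (Dom C m) (tn (ls @ xs @ rs))"
    using okD[OF assms(3)] by auto
  show ?thesis
    by (simp add: layer_append whisker_Comp[OF assms(1,2) o(1,2)]
        Comp_assoc[OF o(3) whisker_Hom[OF assms(1) o(1,2)] whisker_Hom[OF assms(2) o(1,2)]])
qed

lemma gen_Comp: "gen C xs f ys \<Longrightarrow> gen C ys g zs \<Longrightarrow> gen C xs (g \<cdot> f) zs"
  by (auto simp: gen_def intro: Comp_Hom)

lemma gen_Tensor: "gen C xs f ys \<Longrightarrow> gen C xs' g ys' \<Longrightarrow> gen C (xs @ xs') (f \<otimes> g) (ys @ ys')"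
  by (auto simp: gen_def ten_append intro: Tensor_Hom)

lemma denotes_Comp:
  assumes "denotes C xs f ys d" "denotes C ys' g zs e" "ys' = ys"
  shows "denotes C xs (g \<cdot> f) zs (d @ e)"
  unfolding denotes_def
proof (intro conjI allI impI)
  have gf: "gen C xs f ys" and gg: "gen C ys g zs"
    using assms by (auto simp: denotes_def)
  show "gen C xs (g \<cdot> f) zs" using gf gg by (rule gen_Comp)
  fix ls rs m assume ok: "ok C (ls @ xs @ rs, m)"
  have "run C (length ls) d (ls @ xs @ rs, m) = layer C (length ls) xs f ys (ls @ xs @ rs, m)"
    using assms(1) ok by (simp add: denotes_def)
  moreover have "ok C (layer C (length ls) xs f ys (ls @ xs @ rs, m))"
    using layer_ok_append[OF gf ok] by simp
  ultimately show "run C (length ls) (d @ e) (ls @ xs @ rs, m) =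
      layer C (length ls) xs (g \<cdot> f) zs (ls @ xs @ rs, m)"
    using assms(2,3) by (simp add: run_append layer_Comp[OF gf gg ok]) (simp add: layer_append
        denotes_def)
qed

text \<open>The layers of \<open>e\<close> are shifted by \<open>length ys\<close> rather than
  \<open>length xs\<close>, since \<open>d\<close> has already run and replaced the strands to their
  left. The underlying identity is the factorization of \<open>f \<otimes> g\<close> into
  \<open>f\<close> followed by \<open>g\<close>, each whiskered with an identity.\<close>

lemma denotes_Tensor:
  assumes "denotes C xs f ys d" "denotes C xs' g ys' e"
  shows "denotes C (xs @ xs') (f \<otimes> g) (ys @ ys') (d @ shift (length ys) e)"
  unfolding denotes_def
proof (intro conjI allI impI)
  have gf: "gen C xs f ys" and gg: "gen C xs' g ys'"
    using assms by (auto simp: denotes_def)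
  note f = genD[OF gf] note g = genD[OF gg]
  show "gen C (xs @ xs') (f \<otimes> g) (ys @ ys')" using gf gg by (rule gen_Tensor)
  fix ls rs m assume ok: "ok C (ls @ (xs @ xs') @ rs, m)"
  have l: "set ls \<subseteq> Ob C" and r: "set rs \<subseteq> Ob C"
    using okD[OF ok] by auto
  let ?s = "layer C (length ls) xs f ys (ls @ xs @ (xs' @ rs), m)"
  have "run C (length ls) (d @ shift (length ys) e) (ls @ (xs @ xs') @ rs, m)
      = run C (length (ls @ ys)) e (run C (length ls) d (ls @ xs @ (xs' @ rs), m))"
    by (simp add: run_append run_shift)
  also have "run C (length ls) d (ls @ xs @ (xs' @ rs), m) = ?s"
    using assms(1) ok unfolding denotes_def by simp
  also have "run C (length (ls @ ys)) e ?s = layer C (length (ls @ ys)) xs' g ys' ?s"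
  proof -
    have "ok C ?s" using layer_ok_append[OF gf, of ls "xs' @ rs" m] ok by simp
    moreover have "?s = ((ls @ ys) @ xs' @ rs, snd ?s)" by (simp add: layer_append)
    ultimately show ?thesis using assms(2) unfolding denotes_def by metis
  qed
  also have "\<dots> = layer C (length ls) (xs @ xs') (f \<otimes> g) (ys @ ys') (ls @ (xs @ xs') @ rs, m)"
  proof -
    have I: "\<And>us. set us \<subseteq> Ob C \<Longrightarrow> \<I> (tn us) \<in> Hom C (tn us) (tn us)" by (auto intro: Id_Hom)
    have A: "f \<in> Ar C" "g \<in> Ar C" "\<And>us. set us \<subseteq> Ob C \<Longrightarrow> \<I> (tn us) \<in> Ar C"
      using f g I HomD by blast+
    have T: "\<And>x y. x \<in> Ar C \<Longrightarrow> y \<in> Ar C \<Longrightarrow> x \<otimes> y \<in> Ar C"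
      using Tensor_Hom Ar_Hom HomD by blast
    have m: "m \<in> Hom C (Dom C m) (tn (ls @ xs @ xs' @ rs))" using okD[OF ok] by simp
    have 1: "\<I> (tn ls) \<otimes> f \<otimes> \<I> (tn (xs' @ rs)) = \<I> (tn ls) \<otimes> (f \<otimes> \<I> (tn xs')) \<otimes> \<I> (tn rs)"
      using f g l r A by (simp add: Id_ten_append Tensor_assoc)
    have 2: "\<I> (tn (ls @ ys)) \<otimes> g \<otimes> \<I> (tn rs) = \<I> (tn ls) \<otimes> (\<I> (tn ys) \<otimes> g) \<otimes> \<I> (tn rs)"
      using f g l r A T by (simp add: Id_ten_append Tensor_assoc)
    have 3: "f \<otimes> g = (\<I> (tn ys) \<otimes> g) \<cdot> (f \<otimes> \<I> (tn xs'))"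
      using Tensor_Comp[of f _ _ "\<I> (tn ys)" _ "\<I> (tn xs')" _ _ g] f g I by (metis Id_Comp Comp_Id)
    have 4: "gen C (xs @ xs') (f \<otimes> \<I> (tn xs')) (ys @ xs')"
      using gen_Tensor[OF gf, of xs' "\<I> (tn xs')" xs'] g I by (simp add: gen_def)
    have 5: "gen C (ys @ xs') (\<I> (tn ys) \<otimes> g) (ys @ ys')"
      using gen_Tensor[OF _ gg, of ys "\<I> (tn ys)" ys] f I by (simp add: gen_def)
    have "layer C (length (ls @ ys)) xs' g ys' ?s =
        (ls @ ys @ ys' @ rs, (\<I> (tn (ls @ ys)) \<otimes> g \<otimes> \<I> (tn rs)) \<cdot> ((\<I> (tn ls) \<otimes> f \<otimes> \<I> (tn (xs' @
            rs))) \<cdot> m))"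
      using layer_append[of "length (ls @ ys)" "ls @ ys" C xs' g ys' rs] by (simp add: layer_append)
    also have "\<dots> = (ls @ ys @ ys' @ rs, (\<I> (tn ls) \<otimes> (\<I> (tn ys) \<otimes> g) \<otimes> \<I> (tn rs)) \<cdot>
        ((\<I> (tn ls) \<otimes> (f \<otimes> \<I> (tn xs')) \<otimes> \<I> (tn rs)) \<cdot> m))" by (simp only: 1 2)
    also have "\<dots> = (ls @ ys @ ys' @ rs, (\<I> (tn ls) \<otimes> (f \<otimes> g) \<otimes> \<I> (tn rs)) \<cdot> m)"
      unfolding 3 whisker_Comp[OF 4 5 l r]
      using Comp_assoc[OF _ whisker_Hom[OF 4 l r] whisker_Hom[OF 5 l r], of m] m by simp
    finally show ?thesis using layer_append[of "length ls" ls C "xs @ xs'" "f \<otimes> g" "ys @ ys'" rs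
        m] by simp
  qed
  finally show "run C (length ls) (d @ shift (length ys) e) (ls @ (xs @ xs') @ rs, m) =
      layer C (length ls) (xs @ xs') (f \<otimes> g) (ys @ ys') (ls @ (xs @ xs') @ rs, m)" .
qed

text \<open>Run from an identity, a diagram gives back the arrow that it denotes. The
  \<open>denotes\<close> premises are solved by resolution, which also computes \<open>d1\<close>
  and \<open>d2\<close>, so that rewriting only has to compare the two runs.\<close>

lemma diagram_eqI:
  assumes "denotes C xs E1 ys d1" "denotes C xs' E2 ys' d2" "xs' = xs"
    and "run C 0 d1 (start C xs) = run C 0 d2 (start C xs)"
  shows "E1 = E2"
proof -
  have *: "run C 0 d (start C xs) = (ys, E)" if "denotes C xs E ys d" for E ys d
  proof -
    have g: "gen C xs E ys" using that by (simp add: denotes_def)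
    note G = genD[OF g]
    have E: "E \<in> Hom C (tn xs) (tn ys)" "E \<in> Ar C" using G HomD by blast+
    have "ok C ([] @ xs @ [], \<I> (tn xs))" using ok_start[of xs] G by (simp add: start_def)
    from that[unfolded denotes_def, THEN conjunct2, rule_format, OF this] show ?thesis
      using layer_append[of 0 "[]" C xs E ys "[]"] E by (simp add: start_def Tensor_Unit
          Unit_Tensor Comp_Id)
  qed
  show ?thesis using *[OF assms(1)] *[of E2 ys' d2] assms by simp
qed

lemma diagram_rule_aux:
  assumes "E1 = E2" "denotes C xs E1 ys d1" "denotes C xs' E2 ys' d2" "xs' = xs" "ys' = ys" "fits
      C n xs s"
  shows "run C n d1 s = run C n d2 s"
  using assms(6)
proof (rule fitsE)
  fix ls rs m
  assume "s = (ls @ xs @ rs, m)" "length ls = n" "ok C (ls @ xs @ rs, m)"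
  then show ?thesis using assms(1-5) unfolding denotes_def by metis
qed

text \<open>Both composites are \<open>f \<otimes> \<I> (tn ms) \<otimes> g\<close>, with
  \<open>ms\<close> the strands between \<open>xs\<close> and \<open>xs'\<close>, read in two
  orders. \<open>m'\<close> is the position of \<open>g\<close> before \<open>f\<close> acts,
  \<open>m\<close> its position after \<open>f\<close> has changed the number of strands.\<close>

lemma layer_swap:
  assumes "fits C n xs s" "gen C xs f ys" "fits C m' xs' s" "gen C xs' g ys'"
    and "m = m' + length ys - length xs" "n + length xs \<le> m'"
  shows "layer C m xs' g ys' (layer C n xs f ys s) = layer C n xs f ys (layer C m' xs' g ys' s)"
proof -
  obtain ls rs0 a where s0: "s = (ls @ xs @ rs0, a)" "length ls = n" "ok C (ls @ xs @ rs0, a)"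
    using assms(1) by (rule fitsE)
  obtain us rs b where s1: "s = (us @ xs' @ rs, b)" "length us = m'" "ok C (us @ xs' @ rs, b)"
    using assms(3) by (rule fitsE)
  \<comment> \<open>As \<open>xs\<close> ends before \<open>xs'\<close> begins, the strands to the
    left of \<open>xs'\<close> start with \<open>ls @ xs\<close>.\<close>
  have "us = ls @ xs @ drop (n + length xs) us"
  proof -
    have "take (n + length xs) (us @ xs' @ rs) = take (n + length xs) (ls @ xs @ rs0)" using s0 s1
        by simp
    then have "take (n + length xs) us = ls @ xs" using s0 s1 assms by simp
    then show ?thesis by (metis append.assoc append_take_drop_id)
  qed
  then obtain ms where us: "us = ls @ xs @ ms" by blast
  have s: "s = (ls @ xs @ ms @ xs' @ rs, b)" and ok: "ok C (ls @ (xs @ ms @ xs') @ rs, b)" using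
      s1 us by auto
  have m: "m = length (ls @ ys @ ms)" "m' = length (ls @ xs @ ms)"
    using us s0(2) s1(2) assms(5) by auto
  have ms: "set ms \<subseteq> Ob C" using okD[OF ok] by auto
  let ?d = "[(0, xs, f, ys)] @ shift (length ys) ([] @ shift (length ms) [(0, xs', g, ys')])"
  have t: "denotes C (xs @ ms @ xs') (f \<otimes> \<I> (tn ms) \<otimes> g) (ys @ ms @ ys') ?d"
    by (intro denotes_Tensor denotes_gen denotes_Id assms ms refl)
  have Iy: "\<I> (tn ys) \<in> Hom C (tn ys) (tn ys)" and Ix': "\<I> (tn xs') \<in> Hom C (tn xs') (tn xs')"
    and Im: "\<I> (tn ms) \<in> Hom C (tn ms) (tn ms)"
    and Ix: "\<I> (tn xs) \<in> Hom C (tn xs) (tn xs)" and Iy': "\<I> (tn ys') \<in> Hom C (tn ys') (tn ys')"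
    using assms ms by (auto simp: gen_def intro: Id_Hom)
  have fg: "f \<in> Hom C (tn xs) (tn ys)" "g \<in> Hom C (tn xs') (tn ys')" using assms by (auto simp:
      gen_def)
  have e: "f \<otimes> \<I> (tn ms) \<otimes> g = (f \<otimes> \<I> (tn ms) \<otimes> \<I> (tn ys')) \<cdot> (\<I> (tn xs) \<otimes> \<I> (tn ms) \<otimes> g)"
    using Tensor_Comp[OF Ix fg(1) Tensor_Hom[OF Im fg(2)] Tensor_Hom[OF Im Iy']]
      Tensor_Comp[OF Im Im fg(2) Iy'] fg Ix Im Iy' by (metis Comp_Id Id_Comp)
  let ?d' = "([] @ shift (length xs) ([] @ shift (length ms) [(0, xs', g, ys')])) @ ([(0, xs, f,
      ys)] @ shift (length ys) ([] @ shift (length ms) []))"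
  have t': "denotes C (xs @ ms @ xs') ((f \<otimes> \<I> (tn ms) \<otimes> \<I> (tn ys')) \<cdot> (\<I> (tn xs) \<otimes> \<I> (tn ms) \<otimes> g))
      (ys @ ms @ ys') ?d'"
    by (rule denotes_Comp[OF _ _ refl, where ys = "xs @ ms @ ys'"]; intro denotes_Tensor
        denotes_gen denotes_Id assms ms refl)
      (use assms in \<open>auto simp: gen_def\<close>)
  have "fits C n (xs @ ms @ xs') s" using ok s s0(2) by (simp add: fits_def)
  from diagram_rule_aux[OF e t t' refl refl this] show ?thesis using m s0(2) by (simp add: ac_simps)
qed

lemma denotes_gen': "f \<in> Hom C (tn xs) (tn ys) \<Longrightarrow> set xs \<subseteq> Ob C \<Longrightarrow> set ys \<subseteq> Ob C \<Longrightarrow>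
    denotes C xs f ys [(0, xs, f, ys)]"
  by (simp add: denotes_gen gen_def)

lemma denotes_Id1: "a \<in> Ob C \<Longrightarrow> denotes C [a] (\<I> a) [a] []"
  by (simp add: denotes_Id)

lemma denotes_IdK: "denotes C [] (\<I> \<K>) [] []"
  by (simp add: denotes_Id)

text \<open>The lists built by the \<open>denotes\<close> rules equal the intended ones only after
  simplification, so each agreement is a premise of its own.\<close>

lemma diagram_rule:
  assumes "E1 = E2" "denotes C xs E1 ys d1" "denotes C xs' E2 ys' d2" "xs' = xs" "ys' = ys"
    "fits C n zs s" "zs = xs" "e1 = d1" "e2 = d2"
  shows "run C n e1 s = run C n e2 s"
  using diagram_rule_aux[OF assms(1-5)] assms by simp

lemmas denotes_rules = denotes_Comp denotes_Tensor denotes_IdK denotes_Id1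

text \<open>Without the two non-emptiness conditions this rule would undo
  \<open>layer_unit_last\<close> and \<open>layer_counit_first\<close>, and rewriting would
  loop.\<close>

lemma layer_left_first:
  assumes "m + length xs' \<le> n" "xs' \<noteq> []" "ys \<noteq> []"
    and "gen C xs f ys" "gen C xs' g ys'" "fits C n xs s" "fits C m xs' s"
  shows "layer C m xs' g ys' (layer C n xs f ys s) = layer C (n - length xs' + length ys') xs f ys
      (layer C m xs' g ys' s)"
  by (rule layer_swap[OF assms(7,5,6,4) _ assms(1), symmetric]) (use assms(1) in simp)

lemma layer_counit_first:
  assumes "n + length ys \<le> m" "ys \<noteq> []"
    and "gen C xs f ys" "gen C xs' g []" "fits C n xs s" "fits C (m - length ys + length xs) xs' s"
  shows "layer C m xs' g [] (layer C n xs f ys s) = layer C n xs f ys (layer C (m - length ys +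
      length xs) xs' g [] s)"
  by (rule layer_swap[OF assms(5,3,6,4)]) (use assms(1) in auto)

lemma layer_counit_counit:
  assumes "m + length xs' \<le> n" "gen C xs f []" "gen C xs' g []" "fits C n xs s" "fits C m xs' s"
  shows "layer C m xs' g [] (layer C n xs f [] s) = layer C (n - length xs') xs f []
      (layer C m xs' g [] s)"
  by (rule layer_swap[OF assms(5,3,4,2) _ assms(1), symmetric]) (use assms(1) in simp)

lemma layer_unit_last:
  assumes "n + length ys \<le> m" "xs' \<noteq> []"
    and "gen C [] f ys" "gen C xs' g ys'" "fits C n [] s" "fits C (m - length ys) xs' s"
  shows "layer C m xs' g ys' (layer C n [] f ys s) = layer C n [] f ys (layer C (m - length ys)
      xs' g ys' s)"
  by (rule layer_swap[OF assms(5,3,6,4)]) (use assms(1) in auto)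

lemma layer_unit_unit:
  assumes "m \<le> n" "gen C [] f ys" "gen C [] g ys'" "fits C n [] s"
  shows "layer C m [] g ys' (layer C n [] f ys s) = layer C (n + length ys') [] f ys (layer C m []
      g ys' s)"
proof -
  have "fits C m [] s" using assms by (auto simp: fits_def)
  then show ?thesis
    by (rule layer_swap[OF _ assms(3,4,2), symmetric]) (use assms(1) in auto)
qed

text \<open>
  The interchange law, oriented so that layers further to the left come first, counits as early and
  units as late as possible. In this normal form the two sides of a Hopf algebra axiom are usually
  applied consecutively, so that the axiom matches as a rewrite rule.
\<close>

lemmas swap_rules = layer_left_first layer_counit_first layer_counit_counit layer_unit_last
    layer_unit_unit

text \<open>
  An alternative orientation: coproducts first, then braidings, then everything else. It is needed
  where layers without braidings separate a braiding from the strands it could be moved along.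
\<close>

definition rank :: "'a list \<Rightarrow> 'a list \<Rightarrow> nat" where
  "rank xs ys = (if length ys = 2 then length xs else 3)"

lemma layer_left_first_rank:
  assumes "m + length xs' \<le> n" "xs' \<noteq> []" "ys \<noteq> []" "rank xs' ys' \<le> rank xs ys"
    and "gen C xs f ys" "gen C xs' g ys'" "fits C n xs s" "fits C m xs' s"
  shows "layer C m xs' g ys' (layer C n xs f ys s) = layer C (n - length xs' + length ys') xs f ys
      (layer C m xs' g ys' s)"
  by (rule layer_left_first[OF assms(1-3,5-8)])

lemma layer_rank_first:
  assumes "n + length ys \<le> m" "rank xs' ys' < rank xs ys"
    and "gen C xs f ys" "gen C xs' g ys'" "fits C n xs s" "fits C (m - length ys + length xs) xs' s"
  shows "layer C m xs' g ys' (layer C n xs f ys s) = layer C n xs f ys (layer C (m - length ys +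
      length xs) xs' g ys' s)"
  by (rule layer_swap[OF assms(5,3,6,4)]) (use assms(1) in auto)

lemmas braids_first = layer_left_first_rank layer_rank_first rank_def

end

section \<open>Sliding arrows through the braiding\<close>

context strict_braided_category
begin

text \<open>The hexagon identity at \<open>\<K> \<odot> \<K> = \<K>\<close> makes
  \<open>\<c> \<K> a\<close> idempotent, and an invertible idempotent is an identity.\<close>

lemma Braid_Unit_left: assumes a: "a \<in> Ob C" shows "\<c> \<K> a = \<I> a"
proof -
  have c: "\<c> \<K> a \<in> Hom C a a" using Braid_Hom[OF Unit_Ob a] a by (simp add: Unit_Tensor_ob
      Tensor_ob_Unit)
  then have Ar: "\<c> \<K> a \<in> Ar C" using HomD by blast
  have cc: "\<c> \<K> a = \<c> \<K> a \<cdot> \<c> \<K> a"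
    using Braid_Tensor_left[OF Unit_Ob Unit_Ob a] a Ar Unit_Ob by (simp add: Unit_Tensor_ob
        Tensor_Unit Unit_Tensor)
  obtain k where "k \<in> Hom C a a" "k \<cdot> \<c> \<K> a = \<I> a"
    using Braid_iso[OF Unit_Ob a] a by (auto simp: Unit_Tensor_ob Tensor_ob_Unit)
  then show ?thesis using cc Comp_assoc[OF c c] Id_Comp c by metis
qed

lemma Braid_Unit_right: assumes a: "a \<in> Ob C" shows "\<c> a \<K> = \<I> a"
proof -
  have c: "\<c> a \<K> \<in> Hom C a a" using Braid_Hom[OF a Unit_Ob] a by (simp add: Unit_Tensor_ob
      Tensor_ob_Unit)
  then have Ar: "\<c> a \<K> \<in> Ar C" using HomD by blast
  have cc: "\<c> a \<K> = \<c> a \<K> \<cdot> \<c> a \<K>"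
    using Braid_Tensor_right[OF a Unit_Ob Unit_Ob] a Ar Unit_Ob by (simp add: Unit_Tensor_ob
        Tensor_Unit Unit_Tensor)
  obtain k where "k \<in> Hom C a a" "k \<cdot> \<c> a \<K> = \<I> a"
    using Braid_iso[OF a Unit_Ob] a by (auto simp: Unit_Tensor_ob Tensor_ob_Unit)
  then show ?thesis using cc Comp_assoc[OF c c] Id_Comp c by metis
qed

lemma denotes_Braid: "a \<in> Ob C \<Longrightarrow> b \<in> Ob C \<Longrightarrow> denotes C [a, b] (\<c> a b) [b, a] [(0, [a, b], \<c> a b,
    [b, a])]"
  by (rule denotes_gen') (auto intro: Braid_Hom)

lemma gen_Braid [simp]: "a \<in> Ob C \<Longrightarrow> b \<in> Ob C \<Longrightarrow> gen C [a, b] (\<c> a b) [b, a]"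
  by (simp add: gen_def Braid_Hom)

abbreviation "cr n a b s \<equiv> layer C n [a, b] (\<c> a b) [b, a] s"

lemma nat_left: "f \<in> Hom C a b \<Longrightarrow> z \<in> Ob C \<Longrightarrow> \<c> b z \<cdot> (f \<otimes> \<I> z) = (\<I> z \<otimes> f) \<cdot> \<c> a z"
  using Braid_natural Id_Hom by blast

lemma nat_right: "f \<in> Hom C a b \<Longrightarrow> z \<in> Ob C \<Longrightarrow> \<c> z b \<cdot> (\<I> z \<otimes> f) = (f \<otimes> \<I> z) \<cdot> \<c> z a"
  using Braid_natural Id_Hom by blast

lemmas Braid_simps = Braid_Tensor_left Braid_Tensor_right Braid_Unit_left Braid_Unit_right

text \<open>In the names of these lemmas, \<open>left\<close> and \<open>right\<close> tell which of
  the crossing strands carries \<open>f\<close>, and the digits count the inputs and outputs of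
  \<open>f\<close>. Braidings of composite objects are expanded by the hexagon identities, so only
  crossings of single strands occur.\<close>

lemma braid_left_11:
  assumes gen: "gen C [x] f [y]" and fit: "fits C n [x, z] s"
  shows "layer C n [y, z] (\<c> y z) [z, y] (layer C n [x] f [y] s) =
    layer C (n + 1) [x] f [y] (layer C n [x, z] (\<c> x z) [z, x] s)"
proof -
  have "set [x, y, z] \<subseteq> Ob C" using assms by (auto simp: gen_def ok_def elim!: fitsE)
  then have o: "x \<in> Ob C" "y \<in> Ob C" "z \<in> Ob C" by auto
  have f: "f \<in> Hom C (tn [x]) (tn [y])" using assms by (simp add: gen_def)
  have "run C n [(0, [x], f, [y]), (0, [y, z], \<c> y z, [z, y])] s
    = run C n [(0, [x, z], \<c> x z, [z, x]), (1, [x], f, [y])] s"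
    by (rule diagram_rule[OF nat_left[OF f o(3), simplified Braid_simps o ten.simps]])
      ((rule denotes_rules denotes_gen[OF gen] denotes_Braid o fit | simp)+)
  then show ?thesis using assms by simp
qed

lemma braid_left_21:
  assumes gen: "gen C [x, y] f [w]" and fit: "fits C n [x, y, z] s"
  shows "layer C n [w, z] (\<c> w z) [z, w] (layer C n [x, y] f [w] s) =
    layer C (n + 1) [x, y] f [w] (layer C n [x, z] (\<c> x z) [z, x] (layer C (n + 1) [y, z] (\<c> y z)
        [z, y] s))"
proof -
  have "set [w, x, y, z] \<subseteq> Ob C" using assms by (auto simp: gen_def ok_def elim!: fitsE)
  then have o: "w \<in> Ob C" "x \<in> Ob C" "y \<in> Ob C" "z \<in> Ob C" by auto
  have f: "f \<in> Hom C (tn [x, y]) (tn [w])" using assms by (simp add: gen_def)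
  have "run C n [(0, [x, y], f, [w]), (0, [w, z], \<c> w z, [z, w])] s
    = run C n [(1, [y, z], \<c> y z, [z, y]), (0, [x, z], \<c> x z, [z, x]), (1, [x, y], f, [w])] s"
    by (rule diagram_rule[OF nat_left[OF f o(4), simplified Braid_simps o ten.simps]])
      ((rule denotes_rules denotes_gen[OF gen] denotes_Braid o fit | simp)+)
  then show ?thesis using assms by simp
qed

lemma braid_left_12:
  assumes m: "m = n + 1" and gen: "gen C [w] f [x, y]" and fit: "fits C n [w, z] s"
  shows "layer C n [x, z] (\<c> x z) [z, x] (layer C m [y, z] (\<c> y z) [z, y] (layer C n [w] f [x, y]
      s)) =
    layer C (n + 1) [w] f [x, y] (layer C n [w, z] (\<c> w z) [z, w] s)"
proof -
  have "set [w, x, y, z] \<subseteq> Ob C" using assms by (auto simp: gen_def ok_def elim!: fitsE)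
  then have o: "w \<in> Ob C" "x \<in> Ob C" "y \<in> Ob C" "z \<in> Ob C" by auto
  have f: "f \<in> Hom C (tn [w]) (tn [x, y])" using assms by (simp add: gen_def)
  have "run C n [(0, [w], f, [x, y]), (1, [y, z], \<c> y z, [z, y]), (0, [x, z], \<c> x z, [z, x])] s
    = run C n [(0, [w, z], \<c> w z, [z, w]), (1, [w], f, [x, y])] s"
    by (rule diagram_rule[OF nat_left[OF f o(4), simplified Braid_simps o ten.simps]])
      ((rule denotes_rules denotes_gen[OF gen] denotes_Braid o fit | simp)+)
  then show ?thesis using assms by simp
qed

lemma braid_left_01:
  assumes gen: "gen C [] f [w]" and fit: "fits C n [z] s"
  shows "layer C n [w, z] (\<c> w z) [z, w] (layer C n [] f [w] s) =
    layer C (n + 1) [] f [w] s"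
proof -
  have "set [w, z] \<subseteq> Ob C" using assms by (auto simp: gen_def ok_def elim!: fitsE)
  then have o: "w \<in> Ob C" "z \<in> Ob C" by auto
  have f: "f \<in> Hom C (tn []) (tn [w])" using assms by (simp add: gen_def)
  have "run C n [(0, [], f, [w]), (0, [w, z], \<c> w z, [z, w])] s
    = run C n [(1, [], f, [w])] s"
    by (rule diagram_rule[OF nat_left[OF f o(2), simplified Braid_simps o ten.simps]])
      ((rule denotes_rules denotes_gen[OF gen] denotes_Braid o fit | simp)+)
  then show ?thesis using assms by simp
qed

lemma braid_left_10:
  assumes m: "m = n + 1" and gen: "gen C [w] f []" and fit: "fits C n [w, z] s"
  shows "layer C m [w] f [] (layer C n [w, z] (\<c> w z) [z, w] s) =
    layer C n [w] f [] s"
proof -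
  have "set [w, z] \<subseteq> Ob C" using assms by (auto simp: gen_def ok_def elim!: fitsE)
  then have o: "w \<in> Ob C" "z \<in> Ob C" by auto
  have f: "f \<in> Hom C (tn [w]) (tn [])" using assms by (simp add: gen_def)
  have "run C n [(0, [w], f, [])] s
    = run C n [(0, [w, z], \<c> w z, [z, w]), (1, [w], f, [])] s"
    by (rule diagram_rule[OF nat_left[OF f o(2), simplified Braid_simps o ten.simps]])
      ((rule denotes_rules denotes_gen[OF gen] denotes_Braid o fit | simp)+)
  then show ?thesis using assms by simp
qed

lemma braid_right_11:
  assumes m: "m = n + 1" and gen: "gen C [x] f [y]" and fit: "fits C n [z, x] s"
  shows "layer C n [z, y] (\<c> z y) [y, z] (layer C m [x] f [y] s) =
    layer C n [x] f [y] (layer C n [z, x] (\<c> z x) [x, z] s)"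
proof -
  have "set [x, y, z] \<subseteq> Ob C" using assms by (auto simp: gen_def ok_def elim!: fitsE)
  then have o: "x \<in> Ob C" "y \<in> Ob C" "z \<in> Ob C" by auto
  have f: "f \<in> Hom C (tn [x]) (tn [y])" using assms by (simp add: gen_def)
  have "run C n [(1, [x], f, [y]), (0, [z, y], \<c> z y, [y, z])] s
    = run C n [(0, [z, x], \<c> z x, [x, z]), (0, [x], f, [y])] s"
    by (rule diagram_rule[OF nat_right[OF f o(3), simplified Braid_simps o ten.simps]])
      ((rule denotes_rules denotes_gen[OF gen] denotes_Braid o fit | simp)+)
  then show ?thesis using assms by simp
qed

lemma braid_right_21:
  assumes m: "m = n + 1" and gen: "gen C [x, y] f [w]" and fit: "fits C n [z, x, y] s"
  shows "layer C n [z, w] (\<c> z w) [w, z] (layer C m [x, y] f [w] s) =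
    layer C n [x, y] f [w] (layer C (n + 1) [z, y] (\<c> z y) [y, z] (layer C n [z, x] (\<c> z x) [x, z]
        s))"
proof -
  have "set [w, x, y, z] \<subseteq> Ob C" using assms by (auto simp: gen_def ok_def elim!: fitsE)
  then have o: "w \<in> Ob C" "x \<in> Ob C" "y \<in> Ob C" "z \<in> Ob C" by auto
  have f: "f \<in> Hom C (tn [x, y]) (tn [w])" using assms by (simp add: gen_def)
  have "run C n [(1, [x, y], f, [w]), (0, [z, w], \<c> z w, [w, z])] s
    = run C n [(0, [z, x], \<c> z x, [x, z]), (1, [z, y], \<c> z y, [y, z]), (0, [x, y], f, [w])] s"
    by (rule diagram_rule[OF nat_right[OF f o(4), simplified Braid_simps o ten.simps]])
      ((rule denotes_rules denotes_gen[OF gen] denotes_Braid o fit | simp)+)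
  then show ?thesis using assms by simp
qed

lemma braid_right_12:
  assumes m: "m = n + 1" and gen: "gen C [w] f [x, y]" and fit: "fits C n [z, w] s"
  shows "layer C m [z, y] (\<c> z y) [y, z] (layer C n [z, x] (\<c> z x) [x, z] (layer C m [w] f [x, y]
      s)) =
    layer C n [w] f [x, y] (layer C n [z, w] (\<c> z w) [w, z] s)"
proof -
  have "set [w, x, y, z] \<subseteq> Ob C" using assms by (auto simp: gen_def ok_def elim!: fitsE)
  then have o: "w \<in> Ob C" "x \<in> Ob C" "y \<in> Ob C" "z \<in> Ob C" by auto
  have f: "f \<in> Hom C (tn [w]) (tn [x, y])" using assms by (simp add: gen_def)
  have "run C n [(1, [w], f, [x, y]), (0, [z, x], \<c> z x, [x, z]), (1, [z, y], \<c> z y, [y, z])] s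
    = run C n [(0, [z, w], \<c> z w, [w, z]), (0, [w], f, [x, y])] s"
    by (rule diagram_rule[OF nat_right[OF f o(4), simplified Braid_simps o ten.simps]])
      ((rule denotes_rules denotes_gen[OF gen] denotes_Braid o fit | simp)+)
  then show ?thesis using assms by simp
qed

lemma braid_right_01:
  assumes m: "m = n + 1" and gen: "gen C [] f [w]" and fit: "fits C n [z] s"
  shows "layer C n [z, w] (\<c> z w) [w, z] (layer C m [] f [w] s) =
    layer C n [] f [w] s"
proof -
  have "set [w, z] \<subseteq> Ob C" using assms by (auto simp: gen_def ok_def elim!: fitsE)
  then have o: "w \<in> Ob C" "z \<in> Ob C" by auto
  have f: "f \<in> Hom C (tn []) (tn [w])" using assms by (simp add: gen_def)
  have "run C n [(1, [], f, [w]), (0, [z, w], \<c> z w, [w, z])] s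
    = run C n [(0, [], f, [w])] s"
    by (rule diagram_rule[OF nat_right[OF f o(2), simplified Braid_simps o ten.simps]])
      ((rule denotes_rules denotes_gen[OF gen] denotes_Braid o fit | simp)+)
  then show ?thesis using assms by simp
qed

lemma braid_right_10:
  assumes gen: "gen C [w] f []" and fit: "fits C n [z, w] s"
  shows "layer C n [w] f [] (layer C n [z, w] (\<c> z w) [w, z] s) =
    layer C (n + 1) [w] f [] s"
proof -
  have "set [w, z] \<subseteq> Ob C" using assms by (auto simp: gen_def ok_def elim!: fitsE)
  then have o: "w \<in> Ob C" "z \<in> Ob C" by auto
  have f: "f \<in> Hom C (tn [w]) (tn [])" using assms by (simp add: gen_def)
  have "run C n [(1, [w], f, [])] s
    = run C n [(0, [z, w], \<c> z w, [w, z]), (0, [w], f, [])] s"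
    by (rule diagram_rule[OF nat_right[OF f o(2), simplified Braid_simps o ten.simps]])
      ((rule denotes_rules denotes_gen[OF gen] denotes_Braid o fit | simp)+)
  then show ?thesis using assms by simp
qed

lemma gen11: "f \<in> Hom C x y \<Longrightarrow> gen C [x] f [y]"
  and gen21: "f \<in> Hom C (x \<odot> y) z \<Longrightarrow> x \<in> Ob C \<Longrightarrow> y \<in> Ob C \<Longrightarrow> gen C [x, y] f [z]"
  and gen12: "f \<in> Hom C x (y \<odot> z) \<Longrightarrow> y \<in> Ob C \<Longrightarrow> z \<in> Ob C \<Longrightarrow> gen C [x] f [y, z]"
  and gen01: "f \<in> Hom C \<K> x \<Longrightarrow> gen C [] f [x]"
  and gen10: "f \<in> Hom C x \<K> \<Longrightarrow> gen C [x] f []"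
  using HomD by (auto simp: gen_def)

section \<open>Algebra and coalgebra axioms as rewrite rules\<close>

lemma algebraD:
  assumes "algebra C X"
  shows "obj X \<in> Ob C" "eta X \<in> Hom C \<K> (obj X)" "mu X \<in> Hom C (obj X \<odot> obj X) (obj X)"
    "mu X \<cdot> (eta X \<otimes> \<I> (obj X)) = \<I> (obj X)" "mu X \<cdot> (\<I> (obj X) \<otimes> eta X) = \<I> (obj X)"
    "mu X \<cdot> (mu X \<otimes> \<I> (obj X)) = mu X \<cdot> (\<I> (obj X) \<otimes> mu X)"
  using assms by (auto simp: algebra_def)

lemma coalgebraD:
  assumes "coalgebra C X"
  shows "obj X \<in> Ob C" "eps X \<in> Hom C (obj X) \<K>" "delta X \<in> Hom C (obj X) (obj X \<odot> obj X)"
    "(eps X \<otimes> \<I> (obj X)) \<cdot> delta X = \<I> (obj X)" "(\<I> (obj X) \<otimes> eps X) \<cdot> delta X = \<I> (obj X)"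
    "(delta X \<otimes> \<I> (obj X)) \<cdot> delta X = (\<I> (obj X) \<otimes> delta X) \<cdot> delta X"
  using assms by (auto simp: coalgebra_def)

lemma gen_algebra [simp]:
  assumes "algebra C X"
  shows "gen C [] (eta X) [obj X]" "gen C [obj X, obj X] (mu X) [obj X]"
  using algebraD[OF assms] by (simp_all add: gen01 gen21)

lemma gen_coalgebra [simp]:
  assumes "coalgebra C X"
  shows "gen C [obj X] (eps X) []" "gen C [obj X] (delta X) [obj X, obj X]"
  using coalgebraD[OF assms] by (simp_all add: gen10 gen12)

abbreviation "apmu X n s \<equiv> layer C n [obj X, obj X] (mu X) [obj X] s"
abbreviation "apeta X n s \<equiv> layer C n [] (eta X) [obj X] s"
abbreviation "apdelta X n s \<equiv> layer C n [obj X] (delta X) [obj X, obj X] s"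
abbreviation "apeps X n s \<equiv> layer C n [obj X] (eps X) [] s"

text \<open>Products are nested to the left, coproducts in \<open>coalgebra_ap\<close> to the right.
  The premise \<open>m = n + 1\<close> replaces the term \<open>n + 1\<close> in the pattern, which
  would not match a position given as a numeral.\<close>

lemma algebra_ap:
  assumes "algebra C X"
  shows "m = n + 1 \<Longrightarrow> fits C n [obj X, obj X, obj X] s \<Longrightarrow> apmu X n (apmu X m s) = apmu X n (apmu X
      n s)"
    and "fits C n [obj X] s \<Longrightarrow> apmu X n (apeta X n s) = s"
    and "m = n + 1 \<Longrightarrow> fits C n [obj X] s \<Longrightarrow> apmu X n (apeta X m s) = s"
proof -
  note X = algebraD[OF assms]
  note diag_intros = denotes_rules gen_algebra[OF assms, THEN denotes_gen] X(1)
  show "apmu X n (apmu X m s) = apmu X n (apmu X n s)" if fit: "fits C n [obj X, obj X, obj X] s"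
      and "m = n + 1"
  proof -
    let ?m = "([obj X, obj X], mu X, [obj X])"
    have "run C n [(1, ?m), (0, ?m)] s = run C n [(0, ?m), (0, ?m)] s"
      by (rule diagram_rule[OF X(6)[symmetric]], (rule diag_intros fit | simp)+)
    then show ?thesis using that by simp
  qed
  show "apmu X n (apeta X n s) = s" if fit: "fits C n [obj X] s"
  proof -
    have "run C n [(0, [], eta X, [obj X]), (0, [obj X, obj X], mu X, [obj X])] s = run C n [] s"
      by (rule diagram_rule[OF X(4)], (rule diag_intros fit | simp)+)
    then show ?thesis using that by simp
  qed
  show "apmu X n (apeta X m s) = s" if fit: "fits C n [obj X] s" and "m = n + 1"
  proof -
    have "run C n [(1, [], eta X, [obj X]), (0, [obj X, obj X], mu X, [obj X])] s = run C n [] s"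
      by (rule diagram_rule[OF X(5)], (rule diag_intros fit | simp)+)
    then show ?thesis using that by simp
  qed
qed

lemma coalgebra_ap:
  assumes "coalgebra C X"
  shows "fits C n [obj X] s \<Longrightarrow> apdelta X n (apdelta X n s) = apdelta X (n + 1) (apdelta X n s)"
    and "fits C n [obj X] s \<Longrightarrow> apeps X n (apdelta X n s) = s"
    and "m = n + 1 \<Longrightarrow> fits C n [obj X] s \<Longrightarrow> apeps X m (apdelta X n s) = s"
proof -
  note X = coalgebraD[OF assms]
  note diag_intros = denotes_rules gen_coalgebra[OF assms, THEN denotes_gen] X(1)
  show "apdelta X n (apdelta X n s) = apdelta X (n + 1) (apdelta X n s)" if fit: "fits C n [obj X]
      s"
  proof -
    let ?m = "([obj X], delta X, [obj X, obj X])"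
    have "run C n [(0, ?m), (0, ?m)] s = run C n [(0, ?m), (1, ?m)] s"
      by (rule diagram_rule[OF X(6)], (rule diag_intros fit | simp)+)
    then show ?thesis using that by simp
  qed
  show "apeps X n (apdelta X n s) = s" if fit: "fits C n [obj X] s"
  proof -
    have "run C n [(0, [obj X], delta X, [obj X, obj X]), (0, [obj X], eps X, [])] s = run C n [] s"
      by (rule diagram_rule[OF X(4)], (rule diag_intros fit | simp)+)
    then show ?thesis using that by simp
  qed
  show "apeps X m (apdelta X n s) = s" if fit: "fits C n [obj X] s" and "m = n + 1"
  proof -
    have "run C n [(0, [obj X], delta X, [obj X, obj X]), (1, [obj X], eps X, [])] s = run C n [] s"
      by (rule diagram_rule[OF X(5)], (rule diag_intros fit | simp)+)
    then show ?thesis using that by simp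
  qed
qed

lemma fst_start [simp]: "fst (start C xs) = xs" by (simp add: start_def)

lemma take_drop_1: "take 1 (x # xs) = [x]" "drop 1 (x # xs) = xs"
  by simp_all

lemma braid_left_12':
  assumes "m = n + 1" "gen C [w] f [x, y]" "fits C n [w, z] s"
  shows "layer C m [w] f [x, y] (layer C n [w, z] (\<c> w z) [z, w] s) =
    cr n x z (cr (n + 1) y z (layer C n [w] f [x, y] s))"
  using braid_left_12[OF assms] assms(1) by simp

lemma braid_right_12':
  assumes "gen C [w] f [x, y]" "fits C n [z, w] s"
  shows "layer C n [w] f [x, y] (layer C n [z, w] (\<c> z w) [w, z] s) =
    cr (n + 1) z y (cr n z x (layer C (n + 1) [w] f [x, y] s))"
  using braid_right_12[OF _ assms] by simp

lemmas braid_simps = braid_left_11 braid_left_21 braid_left_12' braid_left_01 braid_left_10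
  braid_right_11 braid_right_21 braid_right_12' braid_right_01 braid_right_10

text \<open>
  Naturality moves braidings before products and unary layers but after coproducts. Positions are
  kept as numerals, hence the reversed \<open>One_nat_def\<close>.
\<close>

lemmas diag_simps = One_nat_def[symmetric] take_drop_1 swap_rules braid_simps fits_def

text \<open>Types of long composites are read off from their diagrams.\<close>

lemma denotes_Hom: "denotes C xs E ys d \<Longrightarrow> a = tn xs \<Longrightarrow> b = tn ys \<Longrightarrow> E \<in> Hom C a b"
  by (simp add: denotes_def gen_def)

lemma tensor_ac_sel [simp]:
  "obj (tensor_ac C X Y) = obj X \<odot> obj Y"
  "eta (tensor_ac C X Y) = eta X \<otimes> eta Y"
  "mu (tensor_ac C X Y) = (mu X \<otimes> mu Y) \<cdot> (\<I> (obj X) \<otimes> \<c> (obj Y) (obj X) \<otimes> \<I> (obj Y))"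
  "eps (tensor_ac C X Y) = eps X \<otimes> eps Y"
  "delta (tensor_ac C X Y) = (\<I> (obj X) \<otimes> \<c> (obj X) (obj Y) \<otimes> \<I> (obj Y)) \<cdot> (delta X \<otimes> delta Y)"
  by (simp_all add: tensor_ac_def)

text \<open>By naturality the coproducts slide through the crossing. This provides the source of the
  convolution algebra in \<open>q_mu_f\<close>; \<open>algebra_tensor\<close> provides the target of
  the one in \<open>delta_q\<close>.\<close>

lemma coalgebra_tensor:
  assumes "coalgebra C X" "coalgebra C Y"
  shows "coalgebra C (tensor_ac C X Y)"
proof -
  note X = coalgebraD[OF assms(1)] note Y = coalgebraD[OF assms(2)]
  let ?P = "tensor_ac C X Y"
  let ?I = "\<I> (obj X) \<otimes> \<I> (obj Y)"
  note diag_intros = denotes_rules gen_coalgebra[OF assms(1), THEN denotes_gen]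
      gen_coalgebra[OF assms(2), THEN denotes_gen] denotes_Braid X(1) Y(1)
  note diag_rules = diag_simps coalgebra_ap[OF assms(1)] coalgebra_ap[OF assms(2)] X(1) Y(1) assms
  have "eps ?P \<in> Hom C (obj ?P) \<K>" "delta ?P \<in> Hom C (obj ?P) (obj ?P \<odot> obj ?P)"
    unfolding tensor_ac_sel
    by (rule denotes_Hom, (rule diag_intros | simp only: append.simps)+, simp add: X Y, simp add:
        X Y Tensor_ob_assoc Tensor_Ob)+
  moreover have "(eps ?P \<otimes> ?I) \<cdot> delta ?P = ?I"
    unfolding tensor_ac_sel
    by (rule diagram_eqI, ((rule diag_intros | simp only: append.simps)+)[3],
        simp add: diag_rules del: One_nat_def)
  moreover have "(?I \<otimes> eps ?P) \<cdot> delta ?P = ?I"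
    unfolding tensor_ac_sel
    by (rule diagram_eqI, ((rule diag_intros | simp only: append.simps)+)[3],
        simp add: diag_rules del: One_nat_def)
  moreover have "(delta ?P \<otimes> ?I) \<cdot> delta ?P = (?I \<otimes> delta ?P) \<cdot> delta ?P"
    unfolding tensor_ac_sel
    by (rule diagram_eqI, ((rule diag_intros | simp only: append.simps)+)[3],
        simp add: diag_rules del: One_nat_def)
  ultimately show ?thesis
    using X(1) Y(1) unfolding coalgebra_def by (simp add: Tensor_Id Tensor_Ob)
qed

lemma algebra_tensor:
  assumes "algebra C X" "algebra C Y"
  shows "algebra C (tensor_ac C X Y)"
proof -
  note X = algebraD[OF assms(1)] note Y = algebraD[OF assms(2)]
  let ?P = "tensor_ac C X Y"
  let ?I = "\<I> (obj X) \<otimes> \<I> (obj Y)"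
  note diag_intros = denotes_rules gen_algebra[OF assms(1), THEN denotes_gen]
      gen_algebra[OF assms(2), THEN denotes_gen] denotes_Braid X(1) Y(1)
  note diag_rules = diag_simps algebra_ap[OF assms(1)] algebra_ap[OF assms(2)] X(1) Y(1) assms
  have "eta ?P \<in> Hom C \<K> (obj ?P)" "mu ?P \<in> Hom C (obj ?P \<odot> obj ?P) (obj ?P)"
    unfolding tensor_ac_sel
    by (rule denotes_Hom, (rule diag_intros | simp only: append.simps)+, simp add: X Y
        Tensor_ob_assoc Tensor_Ob, simp add: X Y)+
  moreover have "mu ?P \<cdot> (eta ?P \<otimes> ?I) = ?I"
    unfolding tensor_ac_sel
    by (rule diagram_eqI, ((rule diag_intros | simp only: append.simps)+)[3],
        simp add: diag_rules del: One_nat_def)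
  moreover have "mu ?P \<cdot> (?I \<otimes> eta ?P) = ?I"
    unfolding tensor_ac_sel
    by (rule diagram_eqI, ((rule diag_intros | simp only: append.simps)+)[3],
        simp add: diag_rules del: One_nat_def)
  moreover have "mu ?P \<cdot> (mu ?P \<otimes> ?I) = mu ?P \<cdot> (?I \<otimes> mu ?P)"
    unfolding tensor_ac_sel
    by (rule diagram_eqI, ((rule diag_intros | simp only: append.simps)+)[3],
        simp add: diag_rules del: One_nat_def)
  ultimately show ?thesis
    using X(1) Y(1) unfolding algebra_def by (simp add: Tensor_Id Tensor_Ob)
qed

section \<open>Convolution and Hopf algebras\<close>

definition conv where
  "conv X Y u v = mu Y \<cdot> (u \<otimes> v) \<cdot> delta X"

lemma conv_assoc:
  assumes "coalgebra C X" "algebra C Y"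
    and uvw: "u \<in> Hom C (obj X) (obj Y)" "v \<in> Hom C (obj X) (obj Y)" "w \<in> Hom C (obj X) (obj Y)"
  shows "conv X Y (conv X Y u v) w = conv X Y u (conv X Y v w)"
proof -
  note X = coalgebraD[OF assms(1)] note Y = algebraD[OF assms(2)]
  note diag_intros = denotes_rules gen_coalgebra[OF assms(1), THEN denotes_gen]
      gen_algebra[OF assms(2), THEN denotes_gen] denotes_Braid X(1) Y(1)
    uvw[THEN gen11, THEN denotes_gen]
  note diag_rules = diag_simps coalgebra_ap[OF assms(1)] algebra_ap[OF assms(2)] X(1) Y(1) assms
      gen11
  show ?thesis
    unfolding conv_def
    by (rule diagram_eqI, ((rule diag_intros | simp only: append.simps)+)[3],
        simp add: diag_rules del: One_nat_def)
qed

lemma conv_unit: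
  assumes "coalgebra C X" "algebra C Y"
    and u: "u \<in> Hom C (obj X) (obj Y)"
  shows "conv X Y u (eta Y \<cdot> eps X) = u" "conv X Y (eta Y \<cdot> eps X) u = u"
proof -
  note X = coalgebraD[OF assms(1)] note Y = algebraD[OF assms(2)]
  note diag_intros = denotes_rules gen_coalgebra[OF assms(1), THEN denotes_gen]
      gen_algebra[OF assms(2), THEN denotes_gen] denotes_Braid X(1) Y(1)
    u[THEN gen11, THEN denotes_gen]
  note diag_rules = diag_simps coalgebra_ap[OF assms(1)] algebra_ap[OF assms(2)] X(1) Y(1) assms
      gen11
  show "conv X Y u (eta Y \<cdot> eps X) = u" "conv X Y (eta Y \<cdot> eps X) u = u"
    unfolding conv_def
    by (rule diagram_eqI, ((rule diag_intros | simp only: append.simps)+)[3],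
        simp add: diag_rules del: One_nat_def)+
qed

text \<open>A one-sided inverse \<open>w\<close> of \<open>v\<close> suffices to recover
  \<open>u\<close> from its product with \<open>v\<close>. Uniqueness of inverses is always applied
  in this form.\<close>

lemma conv_cancel_right:
  assumes "coalgebra C X" "algebra C Y"
    and "u \<in> Hom C (obj X) (obj Y)" "v \<in> Hom C (obj X) (obj Y)" "w \<in> Hom C (obj X) (obj Y)"
    and "conv X Y v w = eta Y \<cdot> eps X"
  shows "conv X Y (conv X Y u v) w = u"
  by (simp add: conv_assoc[OF assms(1-5)] assms(6) conv_unit[OF assms(1-3)])

section \<open>Morphisms and Hopf algebra axioms as rewrite rules\<close>

abbreviation "ap1 n x f y s \<equiv> layer C n [x] f [y] s"

lemma coalg_mor_ap:
  assumes "coalg_mor C X Y j" "coalgebra C X" "coalgebra C Y"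
  shows "fits C n [obj X] s \<Longrightarrow> apeps Y n (layer C n [obj X] j [obj Y] s) = apeps X n s"
    and "fits C n [obj X] s \<Longrightarrow> apdelta Y n (layer C n [obj X] j [obj Y] s) =
      layer C (n + 1) [obj X] j [obj Y] (layer C n [obj X] j [obj Y] (apdelta X n s))"
proof -
  note X = coalgebraD[OF assms(2)] note Y = coalgebraD[OF assms(3)]
  have j: "j \<in> Hom C (obj X) (obj Y)" and eq: "eps Y \<cdot> j = eps X" "delta Y \<cdot> j = (j \<otimes> j) \<cdot> delta X"
    using assms(1) by (auto simp: coalg_mor_def)
  note diag_intros = denotes_rules gen_coalgebra[OF assms(2), THEN denotes_gen]
      gen_coalgebra[OF assms(3), THEN denotes_gen] X(1) Y(1)
    j[THEN gen11, THEN denotes_gen]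
  show "apeps Y n (layer C n [obj X] j [obj Y] s) = apeps X n s" if fit: "fits C n [obj X] s"
  proof -
    have "run C n [(0, [obj X], j, [obj Y]), (0, [obj Y], eps Y, [])] s = run C n [(0, [obj X],
        eps X, [])] s"
      by (rule diagram_rule[OF eq(1)], (rule diag_intros fit | simp)+)
    then show ?thesis by simp
  qed
  show "apdelta Y n (layer C n [obj X] j [obj Y] s) =
      layer C (n + 1) [obj X] j [obj Y] (layer C n [obj X] j [obj Y] (apdelta X n s))" if fit:
          "fits C n [obj X] s"
  proof -
    have "run C n [(0, [obj X], j, [obj Y]), (0, [obj Y], delta Y, [obj Y, obj Y])] s
      = run C n [(0, [obj X], delta X, [obj X, obj X]), (0, [obj X], j, [obj Y]), (1, [obj X], j,
          [obj Y])] s"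
      by (rule diagram_rule[OF eq(2)], (rule diag_intros fit | simp)+)
    then show ?thesis by simp
  qed
qed

lemma alg_mor_ap:
  assumes "alg_mor C X Y j" "algebra C X" "algebra C Y"
  shows "fits C n [] s \<Longrightarrow> layer C n [obj X] j [obj Y] (apeta X n s) = apeta Y n s"
    and "fits C n [obj X, obj X] s \<Longrightarrow> layer C n [obj X] j [obj Y] (apmu X n s) =
      apmu Y n (layer C (n + 1) [obj X] j [obj Y] (layer C n [obj X] j [obj Y] s))"
proof -
  note X = algebraD[OF assms(2)] note Y = algebraD[OF assms(3)]
  have j: "j \<in> Hom C (obj X) (obj Y)" and eq: "j \<cdot> eta X = eta Y" "j \<cdot> mu X = mu Y \<cdot> (j \<otimes> j)"
    using assms(1) by (auto simp: alg_mor_def)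
  note diag_intros = denotes_rules gen_algebra[OF assms(2), THEN denotes_gen]
      gen_algebra[OF assms(3), THEN denotes_gen] X(1) Y(1)
    j[THEN gen11, THEN denotes_gen]
  show "layer C n [obj X] j [obj Y] (apeta X n s) = apeta Y n s" if fit: "fits C n [] s"
  proof -
    have "run C n [(0, [], eta X, [obj X]), (0, [obj X], j, [obj Y])] s = run C n [(0, [], eta Y,
        [obj Y])] s"
      by (rule diagram_rule[OF eq(1)], (rule diag_intros fit | simp)+)
    then show ?thesis by simp
  qed
  show "layer C n [obj X] j [obj Y] (apmu X n s) =
      apmu Y n (layer C (n + 1) [obj X] j [obj Y] (layer C n [obj X] j [obj Y] s))" if fit: "fits
          C n [obj X, obj X] s"
  proof -
    have "run C n [(0, [obj X, obj X], mu X, [obj X]), (0, [obj X], j, [obj Y])] s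
      = run C n [(0, [obj X], j, [obj Y]), (1, [obj X], j, [obj Y]), (0, [obj Y, obj Y], mu Y,
          [obj Y])] s"
      by (rule diagram_rule[OF eq(2)], (rule diag_intros fit | simp)+)
    then show ?thesis by simp
  qed
qed

text \<open>Opposite to the orientation in \<open>alg_mor_ap\<close>, for goals where an antipode
  law becomes visible only once the morphism is applied after the product.\<close>

lemma alg_mor_ap':
  assumes "alg_mor C X Y j" "algebra C X" "algebra C Y" "fits C n [obj X, obj X] s" "m = n + 1"
  shows "apmu Y n (layer C m [obj X] j [obj Y] (layer C n [obj X] j [obj Y] s)) =
      layer C n [obj X] j [obj Y] (apmu X n s)"
  using alg_mor_ap(2)[OF assms(1-4)] assms(5) by simp

lemma coalg_mor_ap':
  assumes "coalg_mor C X Y j" "coalgebra C X" "coalgebra C Y" "fits C n [obj X] s" "m = n + 1"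
  shows "layer C m [obj X] j [obj Y] (layer C n [obj X] j [obj Y] (apdelta X n s)) = apdelta Y
      n (layer C n [obj X] j [obj Y] s)"
  using coalg_mor_ap(2)[OF assms(1-4)] assms(5) by simp

lemma Comp_ap:
  assumes "h \<cdot> g = k" "g \<in> Hom C x y" "h \<in> Hom C y z" "fits C n [x] s"
  shows "layer C n [y] h [z] (layer C n [x] g [y] s) = layer C n [x] k [z] s"
proof -
  have k: "k \<in> Hom C x z" using assms Comp_Hom by blast
  note diag_intros = denotes_Comp assms(2,3)[THEN gen11, THEN denotes_gen] k[THEN gen11,
      THEN denotes_gen] assms(4)
  have "run C n [(0, [x], g, [y]), (0, [y], h, [z])] s = run C n [(0, [x], k, [z])] s"
    by (rule diagram_rule[OF assms(1)], (rule diag_intros | simp)+)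
  then show ?thesis by simp
qed

lemma Comp_ap_Id:
  assumes "h \<cdot> g = \<I> x" "g \<in> Hom C x y" "h \<in> Hom C y x" "fits C n [x] s"
  shows "layer C n [y] h [x] (layer C n [x] g [y] s) = s"
proof -
  note diag_intros = denotes_Comp assms(2,3)[THEN gen11, THEN denotes_gen] denotes_Id1
      HomD[OF assms(2)] assms(4)
  have "run C n [(0, [x], g, [y]), (0, [y], h, [x])] s = run C n [] s"
    by (rule diagram_rule[OF assms(1)], (rule diag_intros | simp add: HomD[OF assms(2)])+)
  then show ?thesis by simp
qed

lemma hopf_algebraD [simp]:
  assumes "hopf_algebra C X"
  shows "algebra C X" "coalgebra C X" "gen C [obj X] (lam X) [obj X]"
  using assms unfolding hopf_algebra_def by (blast intro: gen11)+

lemma hopf_ap: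
  assumes H: "hopf_algebra C X"
  shows "fits C n [obj X, obj X] s \<Longrightarrow> apeps X n (apmu X n s) = apeps X n (apeps X n s)"
    and "fits C n [] s \<Longrightarrow> apeps X n (apeta X n s) = s"
    and "fits C n [obj X, obj X] s \<Longrightarrow> apdelta X n (apmu X n s) =
      apmu X (n + 1) (apmu X n (cr (n + 1) (obj X) (obj X) (apdelta X (n + 2) (apdelta X n s))))"
    and "fits C n [] s \<Longrightarrow> apdelta X n (apeta X n s) = apeta X (n + 1) (apeta X n s)"
    and "fits C n [obj X] s \<Longrightarrow> apmu X n (layer C n [obj X] (lam X) [obj X] (apdelta X n s)) =
        apeta X n (apeps X n s)"
    and "m = n + 1 \<Longrightarrow> fits C n [obj X] s \<Longrightarrow>
      apmu X n (layer C m [obj X] (lam X) [obj X] (apdelta X n s)) = apeta X n (apeps X n s)"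
proof -
  have alg: "algebra C X" and co: "coalgebra C X" and lam: "lam X \<in> Hom C (obj X) (obj X)"
    and e: "eps X \<cdot> eta X = \<I> \<K>" "eps X \<cdot> mu X = \<I> \<K> \<cdot> (eps X \<otimes> eps X)"
    and d: "delta X \<cdot> eta X = eta X \<otimes> eta X"
      "delta X \<cdot> mu X = (mu X \<otimes> mu X) \<cdot> (\<I> (obj X) \<otimes> \<c> (obj X) (obj X) \<otimes> \<I> (obj X)) \<cdot> (delta X \<otimes>
          delta X)"
    and l: "mu X \<cdot> (lam X \<otimes> \<I> (obj X)) \<cdot> delta X = eta X \<cdot> eps X"
      "mu X \<cdot> (\<I> (obj X) \<otimes> lam X) \<cdot> delta X = eta X \<cdot> eps X"
    using H unfolding hopf_algebra_def alg_mor_def unit_ac_def tensor_ac_sel by simp_all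
  note X = algebraD[OF alg]
  note diag_intros = denotes_rules gen_algebra[OF alg, THEN denotes_gen] gen_coalgebra[OF co,
      THEN denotes_gen] denotes_Braid X(1)
    lam[THEN gen11, THEN denotes_gen]
  let ?e = "(0::nat, [obj X], eps X, [])" and ?u = "(0::nat, [], eta X, [obj X])"
  let ?d = "\<lambda>i::nat. (i, [obj X], delta X, [obj X, obj X])" and ?m = "\<lambda>i::nat. (i, [obj X, obj X],
      mu X, [obj X])"
    and ?l = "\<lambda>i::nat. (i, [obj X], lam X, [obj X])"
  show "apeps X n (apmu X n s) = apeps X n (apeps X n s)" if fit: "fits C n [obj X, obj X] s"
  proof -
    have "run C n [?m 0, ?e] s = run C n [?e, ?e] s"
      by (rule diagram_rule[OF e(2)], (rule diag_intros fit | simp)+)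
    then show ?thesis by simp
  qed
  show "apeps X n (apeta X n s) = s" if fit: "fits C n [] s"
  proof -
    have "run C n [?u, ?e] s = run C n [] s"
      by (rule diagram_rule[OF e(1)], (rule diag_intros fit | simp)+)
    then show ?thesis by simp
  qed
  show "apdelta X n (apeta X n s) = apeta X (n + 1) (apeta X n s)" if fit: "fits C n [] s"
  proof -
    have "run C n [?u, ?d 0] s = run C n [?u, (1, [], eta X, [obj X])] s"
      by (rule diagram_rule[OF d(1)], (rule diag_intros fit | simp)+)
    then show ?thesis by simp
  qed
  show "apdelta X n (apmu X n s) =
      apmu X (n + 1) (apmu X n (cr (n + 1) (obj X) (obj X) (apdelta X (n + 2) (apdelta X n s))))"
    if fit: "fits C n [obj X, obj X] s"
  proof -
    have "run C n [?m 0, ?d 0] s =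
      run C n [?d 0, ?d 2, (1, [obj X, obj X], \<c> (obj X) (obj X), [obj X, obj X]), ?m 0, ?m 1] s"
      by (rule diagram_rule[OF d(2)], (rule diag_intros fit | simp)+)
    then show ?thesis by (simp add: numeral_2_eq_2)
  qed
  show "apmu X n (layer C n [obj X] (lam X) [obj X] (apdelta X n s)) = apeta X n (apeps X n s)"
    if fit: "fits C n [obj X] s"
  proof -
    have "run C n [?d 0, ?l 0, ?m 0] s = run C n [?e, ?u] s"
      by (rule diagram_rule[OF l(1)], (rule diag_intros fit | simp)+)
    then show ?thesis by simp
  qed
  show "apmu X n (layer C m [obj X] (lam X) [obj X] (apdelta X n s)) = apeta X n (apeps X n s)"
    if fit: "fits C n [obj X] s" and "m = n + 1"
  proof -
    have "run C n [?d 0, ?l 1, ?m 0] s = run C n [?e, ?u] s"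
      by (rule diagram_rule[OF l(2)], (rule diag_intros fit | simp)+)
    then show ?thesis using that by simp
  qed
qed

text \<open>\<open>j \<cdot> lam X\<close> is a left and \<open>lam Y \<cdot> j\<close> a right
  convolution inverse of \<open>j\<close>, so they coincide.\<close>

lemma hopf_mor_lam:
  assumes "hopf_algebra C X" "hopf_algebra C Y" "hopf_mor C X Y j"
  shows "j \<cdot> lam X = lam Y \<cdot> j"
proof -
  have m: "alg_mor C X Y j" "coalg_mor C X Y j" using assms(3) by (auto simp: hopf_mor_def)
  have j: "j \<in> Hom C (obj X) (obj Y)" using m by (auto simp: alg_mor_def)
  have o: "obj X \<in> Ob C" "obj Y \<in> Ob C" using j HomD by auto
  note diag_intros = denotes_rules gen_algebra[THEN denotes_gen] gen_coalgebra[THEN denotes_gen] o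
      assms(1,2)[THEN hopf_algebraD(3), THEN denotes_gen] j[THEN gen11, THEN denotes_gen]
     assms(1,2)[THEN hopf_algebraD(1)] assms(1,2)[THEN hopf_algebraD(2)]
  note diag_rules = diag_simps hopf_ap[OF assms(1)] hopf_ap[OF assms(2)] alg_mor_ap(1)[OF m(1)]
      alg_mor_ap'[OF m(1)] coalg_mor_ap(1)[OF m(2)] o j[THEN gen11] assms
  have 1: "conv X Y (j \<cdot> lam X) j = eta Y \<cdot> eps X"
    unfolding conv_def
    by (rule diagram_eqI, ((rule diag_intros | simp only: append.simps)+)[3],
        simp add: diag_rules del: One_nat_def)
  have 2: "conv X Y j (lam Y \<cdot> j) = eta Y \<cdot> eps X"
    unfolding conv_def
    by (rule diagram_eqI, ((rule diag_intros | simp only: append.simps)+)[3],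
        simp add: diag_rules coalg_mor_ap'[OF m(2)] del: One_nat_def)
  have l: "lam X \<in> Hom C (obj X) (obj X)" "lam Y \<in> Hom C (obj Y) (obj Y)"
    using assms(1,2) unfolding hopf_algebra_def by blast+
  have jl: "j \<cdot> lam X \<in> Hom C (obj X) (obj Y)" "lam Y \<cdot> j \<in> Hom C (obj X) (obj Y)"
    using j l Comp_Hom by blast+
  have "j \<cdot> lam X = conv X Y (conv X Y (j \<cdot> lam X) j) (lam Y \<cdot> j)"
    by (rule conv_cancel_right[OF _ _ jl(1) j jl(2) 2, symmetric]) (simp_all add: assms)
  also have "\<dots> = lam Y \<cdot> j"
    unfolding 1 by (rule conv_unit(2)[OF _ _ jl(2)]) (simp_all add: assms)
  finally show ?thesis .
qed

lemma lam_Hom: "hopf_algebra C X \<Longrightarrow> lam X \<in> Hom C (obj X) (obj X)"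
  unfolding hopf_algebra_def by blast

text \<open>With x1, x2 for the legs of the coproduct: eps(lam(x)) = eps(lam(x1)) eps(x2) =
  eps(lam(x1) x2) = eps(x).\<close>

lemma eps_lam:
  assumes X: "hopf_algebra C X" shows "eps X \<cdot> lam X = eps X"
proof -
  note o = algebraD(1)[OF hopf_algebraD(1)[OF X]]
  note diag_intros = denotes_rules X[THEN hopf_algebraD(1), THEN gen_algebra(1), THEN denotes_gen]
      X[THEN hopf_algebraD(1), THEN gen_algebra(2), THEN denotes_gen]
     X[THEN hopf_algebraD(2), THEN gen_coalgebra(1), THEN denotes_gen] X[THEN hopf_algebraD(2),
         THEN gen_coalgebra(2), THEN denotes_gen]
     X[THEN hopf_algebraD(3), THEN denotes_gen] o
  note diag_rules = diag_simps coalgebra_ap algebra_ap X o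
  let ?l = "\<lambda>s. layer C 0 [obj X] (lam X) [obj X] s" and ?s = "start C [obj X]"
  have "apeps X 0 (?l ?s) = apeps X 0 (apeps X 0 (?l (apdelta X 0 ?s)))"
  proof -
    let ?u = "?l (apdelta X 0 ?s)"
    \<comment> \<open>Discarding the right strand first goes against the normal form for two
      counits, but it exposes the counit law; therefore \<open>layer_counit_counit\<close> is
      switched off afterwards.\<close>
    have "apeps X 0 (apeps X 0 ?u) = apeps X 0 (apeps X 1 ?u)"
      by (rule layer_swap) (simp_all add: diag_rules del: One_nat_def)
    then show ?thesis by (simp add: diag_rules del: One_nat_def layer_counit_counit)
  qed
  also have "\<dots> = apeps X 0 (apmu X 0 (?l (apdelta X 0 ?s)))"
    by (simp add: diag_rules hopf_ap(1)[OF X] del: One_nat_def)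
  also have "\<dots> = apeps X 0 ?s"
    by (simp add: diag_rules hopf_ap(2,5)[OF X] del: One_nat_def)
  finally have "apeps X 0 (?l ?s) = apeps X 0 ?s" .
  then show ?thesis
    by - (rule diagram_eqI, ((rule diag_intros | simp only: append.simps)+)[3], simp add: o)
qed

text \<open>The unit is group-like, so the product of lam(1) and 1 is an instance of the antipode
  law.\<close>

lemma lam_eta:
  assumes X: "hopf_algebra C X" shows "lam X \<cdot> eta X = eta X"
proof -
  note o = algebraD(1)[OF hopf_algebraD(1)[OF X]]
  note diag_intros = denotes_rules X[THEN hopf_algebraD(1), THEN gen_algebra(1), THEN denotes_gen]
      X[THEN hopf_algebraD(1), THEN gen_algebra(2), THEN denotes_gen]
     X[THEN hopf_algebraD(2), THEN gen_coalgebra(1), THEN denotes_gen] X[THEN hopf_algebraD(2),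
         THEN gen_coalgebra(2), THEN denotes_gen]
     X[THEN hopf_algebraD(3), THEN denotes_gen] o
  note diag_rules = diag_simps coalgebra_ap algebra_ap X o
  let ?l = "\<lambda>s. layer C 0 [obj X] (lam X) [obj X] s" and ?s = "start C []"
  have "?l (apeta X 0 ?s) = apmu X 0 (?l (apdelta X 0 (apeta X 0 ?s)))"
    by (simp add: diag_rules hopf_ap(4)[OF X] del: One_nat_def)
  also have "\<dots> = apeta X 0 ?s"
    by (simp add: diag_rules hopf_ap(2,5)[OF X] del: One_nat_def)
  finally have "?l (apeta X 0 ?s) = apeta X 0 ?s" .
  then show ?thesis
    by - (rule diagram_eqI, ((rule diag_intros | simp only: append.simps)+)[3], simp add: o)
qed

lemma lam_ap:
  assumes X: "hopf_algebra C X"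
  shows "fits C n [obj X] s \<Longrightarrow> apeps X n (layer C n [obj X] (lam X) [obj X] s) = apeps X n s"
    and "fits C n [] s \<Longrightarrow> layer C n [obj X] (lam X) [obj X] (apeta X n s) = apeta X n s"
proof -
  note o = algebraD(1)[OF hopf_algebraD(1)[OF X]]
  note diag_intros = denotes_rules X[THEN hopf_algebraD(1), THEN gen_algebra(1), THEN denotes_gen]
     X[THEN hopf_algebraD(2), THEN gen_coalgebra(1), THEN denotes_gen] X[THEN hopf_algebraD(3),
         THEN denotes_gen] o
  show "apeps X n (layer C n [obj X] (lam X) [obj X] s) = apeps X n s" if fit: "fits C n [obj X] s"
  proof -
    have "run C n [(0, [obj X], lam X, [obj X]), (0, [obj X], eps X, [])] s =
        run C n [(0, [obj X], eps X, [])] s"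
      by (rule diagram_rule[OF eps_lam[OF X]], (rule diag_intros fit | simp)+)
    then show ?thesis by simp
  qed
  show "layer C n [obj X] (lam X) [obj X] (apeta X n s) = apeta X n s" if fit: "fits C n [] s"
  proof -
    have "run C n [(0, [], eta X, [obj X]), (0, [obj X], lam X, [obj X])] s = run C n [(0, [],
        eta X, [obj X])] s"
      by (rule diagram_rule[OF lam_eta[OF X]], (rule diag_intros fit | simp)+)
    then show ?thesis by simp
  qed
qed

text \<open>Transports convolution inverses along a change of the source;
  \<open>conv_postcomp\<close> does so for the target.\<close>

lemma conv_precomp:
  assumes k: "coalg_mor C P X k" and P: "coalgebra C P" and X: "coalgebra C X" and Z: "algebra C Z"
    and u: "u \<in> Hom C (obj X) (obj Z)" and v: "v \<in> Hom C (obj X) (obj Z)"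
  shows "conv X Z u v \<cdot> k = conv P Z (u \<cdot> k) (v \<cdot> k)"
proof -
  have kH: "k \<in> Hom C (obj P) (obj X)" using k by (simp add: coalg_mor_def)
  note o = coalgebraD(1)[OF P] coalgebraD(1)[OF X] algebraD(1)[OF Z]
  note diag_intros = denotes_rules gen_coalgebra[OF X, THEN denotes_gen] gen_coalgebra[OF P,
      THEN denotes_gen] gen_algebra[OF Z, THEN denotes_gen]
     kH[THEN gen11, THEN denotes_gen] u[THEN gen11, THEN denotes_gen] v[THEN gen11,
         THEN denotes_gen] o
  show ?thesis unfolding conv_def
    by (rule diagram_eqI, ((rule diag_intros | simp only: append.simps)+)[3],
        simp add: diag_simps coalg_mor_ap[OF k P X] P X Z gen11 u v kH o del: One_nat_def)
qed

lemma conv_postcomp: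
  assumes k: "alg_mor C Y Z k" and X: "coalgebra C X" and Y: "algebra C Y" and Z: "algebra C Z"
    and u: "u \<in> Hom C (obj X) (obj Y)" and v: "v \<in> Hom C (obj X) (obj Y)"
  shows "k \<cdot> conv X Y u v = conv X Z (k \<cdot> u) (k \<cdot> v)"
proof -
  have kH: "k \<in> Hom C (obj Y) (obj Z)" using k by (simp add: alg_mor_def)
  note o = coalgebraD(1)[OF X] algebraD(1)[OF Y] algebraD(1)[OF Z]
  note diag_intros = denotes_rules gen_coalgebra[OF X, THEN denotes_gen] gen_algebra[OF Y,
      THEN denotes_gen] gen_algebra[OF Z, THEN denotes_gen]
     kH[THEN gen11, THEN denotes_gen] u[THEN gen11, THEN denotes_gen] v[THEN gen11,
         THEN denotes_gen] o
  show ?thesis unfolding conv_def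
    by (rule diagram_eqI, ((rule diag_intros | simp only: append.simps)+)[3],
        simp add: diag_simps alg_mor_ap[OF k Y Z] X Y Z gen11 u v kH o del: One_nat_def)
qed

lemma conv_antipode:
  assumes X: "hopf_algebra C X"
  shows "conv X X (lam X) (\<I> (obj X)) = eta X \<cdot> eps X" "conv X X (\<I> (obj X)) (lam X) = eta X \<cdot>
      eps X"
  using X unfolding hopf_algebra_def conv_def by blast+

text \<open>The antipode law is an identity in the convolution algebra of \<open>X\<close> and can
  be pulled back along \<open>k\<close>. Thus a coalgebra morphism into a Hopf algebra is invertible
  for convolution.\<close>

lemma conv_coalg_mor_antipode:
  assumes k: "coalg_mor C P X k" and P: "coalgebra C P" and X: "hopf_algebra C X"
  shows "conv P X k (lam X \<cdot> k) = eta X \<cdot> eps P"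
proof -
  have kH: "k \<in> Hom C (obj P) (obj X)" "eps X \<cdot> k = eps P" using k by (simp_all add: coalg_mor_def)
  have H: "eta X \<in> Hom C \<K> (obj X)" "eps X \<in> Hom C (obj X) \<K>"
    using algebraD(2) coalgebraD(2) X hopf_algebraD by blast+
  have "conv P X (\<I> (obj X) \<cdot> k) (lam X \<cdot> k) = conv X X (\<I> (obj X)) (lam X) \<cdot> k"
    by (rule conv_precomp[OF k P, symmetric]) (use X lam_Hom Id_Hom HomD kH in auto)
  then show ?thesis
    unfolding conv_antipode(2)[OF X] using Comp_assoc[OF kH(1) H(2,1)] kH Id_Comp by simp
qed

lemma coalgebra_unit: "coalgebra C (unit_ac C)"
  using Unit_Ob Id_Hom[OF Unit_Ob] HomD[OF Id_Hom[OF Unit_Ob]]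
  by (auto simp: coalgebra_def unit_ac_def Tensor_Unit Unit_Tensor_ob Comp_Id Tensor_Id)

lemma conv_antipode_coalg_mor:
  assumes k: "coalg_mor C P X k" and P: "coalgebra C P" and X: "hopf_algebra C X"
  shows "conv P X (lam X \<cdot> k) k = eta X \<cdot> eps P"
proof -
  have kH: "k \<in> Hom C (obj P) (obj X)" "eps X \<cdot> k = eps P" using k by (simp_all add: coalg_mor_def)
  have H: "eta X \<in> Hom C \<K> (obj X)" "eps X \<in> Hom C (obj X) \<K>"
    using algebraD(2) coalgebraD(2) X hopf_algebraD by blast+
  have "conv P X (lam X \<cdot> k) (\<I> (obj X) \<cdot> k) = conv X X (lam X) (\<I> (obj X)) \<cdot> k"
    by (rule conv_precomp[OF k P, symmetric]) (use X lam_Hom Id_Hom HomD kH in auto)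
  then show ?thesis
    unfolding conv_antipode(1)[OF X] using Comp_assoc[OF kH(1) H(2,1)] kH Id_Comp by simp
qed

lemma cocommutative_ap:
  assumes "cocommutative C X" "coalgebra C X" and fit: "fits C n [obj X] s"
  shows "cr n (obj X) (obj X) (apdelta X n s) = apdelta X n s"
proof -
  note o = coalgebraD(1)[OF assms(2)]
  note diag_intros = denotes_rules gen_coalgebra[OF assms(2), THEN denotes_gen] o denotes_Braid
  have "run C n [(0, [obj X], delta X, [obj X, obj X]), (0, [obj X, obj X], \<c> (obj X) (obj X),
      [obj X, obj X])] s
    = run C n [(0, [obj X], delta X, [obj X, obj X])] s"
    by (rule diagram_rule[OF assms(1)[unfolded cocommutative_def]], (rule diag_intros fit | simp)+)
  then show ?thesis by simp
qed

text \<open>The first two of three legs are the outputs of one coproduct, but only in the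
  left-nested form; coassociativity mediates between it and the right-nested normal form.\<close>

lemma cocommutative_ap':
  assumes "cocommutative C X" "coalgebra C X" and fit: "fits C n [obj X] s" and m: "m = n + 1"
  shows "cr n (obj X) (obj X) (apdelta X m (apdelta X n s)) = apdelta X m (apdelta X n s)"
proof -
  have "fits C n [obj X] (apdelta X n s)"
    using ok_layer[OF fit gen_coalgebra(2)[OF assms(2)]] fit by (auto simp: fits_def)
  then show ?thesis
    using cocommutative_ap[OF assms(1,2)] coalgebra_ap(1)[OF assms(2) fit] m by metis
qed

text \<open>Under \<open>braids_first\<close> a coproduct on a strand further to the right can stand
  between the iterated coproduct and the crossing. This version matches across it, for use in
  \<open>delta_mubar\<close>.\<close>

lemma cocommutative_ap'':
  assumes "n + 3 \<le> k" "m = n + 1" "cocommutative C X" "coalgebra C X" "gen C [y] d [y', y'']"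
    and "fits C n [obj X] s" and "fits C k [y] (apdelta X m (apdelta X n s))"
  shows "cr n (obj X) (obj X) (layer C k [y] d [y', y''] (apdelta X m (apdelta X n s))) =
    layer C k [y] d [y', y''] (apdelta X m (apdelta X n s))"
proof -
  let ?u = "apdelta X m (apdelta X n s)"
  have o: "obj X \<in> Ob C" by (rule coalgebraD(1)[OF assms(4)])
  have 1: "fits C n [obj X] (apdelta X n s)" "fits C m [obj X] (apdelta X n s)"
    using ok_layer[OF assms(6) gen_coalgebra(2)[OF assms(4)]] assms(2,6) by (auto simp: fits_def)
  have 2: "fits C n [obj X, obj X] ?u"
    using ok_layer[OF 1(2) gen_coalgebra(2)[OF assms(4)]] assms(2,6) by (auto simp: fits_def
        min_def)
  have "cr n (obj X) (obj X) (layer C k [y] d [y', y''] ?u) = layer C k [y] d [y', y''] (cr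
      n (obj X) (obj X) ?u)"
    by (rule layer_swap[OF 2 gen_Braid[OF o o] assms(7,5), symmetric]) (use assms(1) in auto)
  then show ?thesis using cocommutative_ap'[OF assms(3,4,6,2)] by simp
qed

lemma alg_mor_Comp:
  assumes "alg_mor C X Y u" "alg_mor C Y Z v" "algebra C X" "algebra C Y" "algebra C Z"
  shows "alg_mor C X Z (v \<cdot> u)"
proof -
  have u: "u \<in> Hom C (obj X) (obj Y)" "u \<cdot> eta X = eta Y" "u \<cdot> mu X = mu Y \<cdot> (u \<otimes> u)"
    and v: "v \<in> Hom C (obj Y) (obj Z)" "v \<cdot> eta Y = eta Z" "v \<cdot> mu Y = mu Z \<cdot> (v \<otimes> v)"
    using assms by (auto simp: alg_mor_def)
  note X = algebraD[OF assms(3)]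
  have "v \<cdot> u \<in> Hom C (obj X) (obj Z)" by (rule Comp_Hom[OF u(1) v(1)])
  moreover have "v \<cdot> u \<cdot> eta X = eta Z" unfolding Comp_assoc[OF X(2) u(1) v(1)] u v ..
  moreover have "v \<cdot> u \<cdot> mu X = mu Z \<cdot> ((v \<cdot> u) \<otimes> (v \<cdot> u))"
  proof -
    have m: "mu Y \<in> Hom C (obj Y \<odot> obj Y) (obj Y)" "mu Z \<in> Hom C (obj Z \<odot> obj Z) (obj Z)"
      using algebraD(3) assms(4,5) by blast+
    show ?thesis
      unfolding Comp_assoc[OF X(3) u(1) v(1)] u(3) Comp_assoc[OF Tensor_Hom[OF u(1,1)] m(1) v(1),
          symmetric] v(3)
        Tensor_Comp[OF u(1) v(1) u(1) v(1)]
      by (rule Comp_assoc[OF Tensor_Hom[OF u(1,1)] Tensor_Hom[OF v(1,1)] m(2)])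
  qed
  ultimately show ?thesis by (simp add: alg_mor_def)
qed

end

section \<open>Projections of Hopf algebras\<close>

locale hopf_proj = strict_braided_category +
  fixes X Y :: "('a, 'b) hopf" and f g :: 'b and I :: 'a and p i :: 'b
  assumes proj: "hopf_projection C X Y f g"
    and split: "splitting C (proj_idem C X Y f g) (obj Y) I p i"
begin

definition "q = proj_idem C X Y f g"

lemma hopf: "hopf_algebra C X" "hopf_algebra C Y" "hopf_mor C X Y f" "hopf_mor C Y X g"
    "g \<cdot> f = \<I> (obj X)"
  using proj by (auto simp: hopf_projection_def)

lemma mor: "alg_mor C X Y f" "coalg_mor C X Y f" "alg_mor C Y X g" "coalg_mor C Y X g"
  using hopf by (auto simp: hopf_mor_def)

lemma alg: "algebra C X" "algebra C Y" "coalgebra C X" "coalgebra C Y"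
  using hopf by auto

lemma ob: "obj X \<in> Ob C" "obj Y \<in> Ob C" "I \<in> Ob C"
  using algebraD(1) alg split by (auto simp: splitting_def)

lemma Homs: "f \<in> Hom C (obj X) (obj Y)" "g \<in> Hom C (obj Y) (obj X)"
    "p \<in> Hom C (obj Y) I" "i \<in> Hom C I (obj Y)" "lam X \<in> Hom C (obj X) (obj X)" "lam Y \<in>
        Hom C (obj Y) (obj Y)"
  using mor split hopf lam_Hom by (auto simp: splitting_def alg_mor_def)

lemma pi: "i \<cdot> p = q" "p \<cdot> i = \<I> I"
  using split by (auto simp: splitting_def q_def)

lemma q_Hom: "q \<in> Hom C (obj Y) (obj Y)"
  using pi Homs Comp_Hom by metis

lemmas diag_intros = denotes_rules gen_algebra[OF alg(1), THEN denotes_gen] gen_algebra[OF alg(2),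
    THEN denotes_gen] gen_coalgebra[OF alg(3), THEN denotes_gen]
   gen_coalgebra[OF alg(4), THEN denotes_gen] ob Homs[THEN gen11, THEN denotes_gen]
       q_Hom[THEN gen11, THEN denotes_gen] denotes_Braid

lemmas diag_rules = diag_simps alg ob Homs[THEN gen11] q_Hom[THEN gen11] coalgebra_ap[OF alg(3)]
    coalgebra_ap[OF alg(4)]
   algebra_ap[OF alg(1)] algebra_ap[OF alg(2)] hopf_ap[OF hopf(1)] hopf_ap[OF hopf(2)]
       lam_ap[OF hopf(1)] lam_ap[OF hopf(2)] hopf
   alg_mor_ap[OF mor(1) alg(1,2)] alg_mor_ap[OF mor(3) alg(2,1)] coalg_mor_ap[OF mor(2) alg(3,4)]
       coalg_mor_ap[OF mor(4) alg(4,3)]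
   Comp_ap_Id[OF pi(2) Homs(4,3)] Comp_ap[OF pi(1) Homs(3,4)] Comp_ap_Id[OF hopf(5) Homs(1,2)]

lemma q_conv: "q = conv Y Y (\<I> (obj Y)) (f \<cdot> lam X \<cdot> g)"
  by (simp add: q_def proj_idem_def conv_def)

text \<open>The factorization y = q(y) f(g(y)). It holds because \<open>f \<cdot> g\<close> is a
  right convolution inverse of the second factor \<open>f \<cdot> lam X \<cdot> g\<close> of
  \<open>q\<close>.\<close>

lemma conv_q: "conv Y Y q (f \<cdot> g) = \<I> (obj Y)"
proof -
  have h: "f \<cdot> lam X \<cdot> g \<in> Hom C (obj Y) (obj Y)" "f \<cdot> g \<in> Hom C (obj Y) (obj Y)"
    and lg: "lam X \<cdot> g \<in> Hom C (obj Y) (obj X)"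
    using Homs Comp_Hom by blast+
  have eta: "eta X \<in> Hom C \<K> (obj X)" "eps Y \<in> Hom C (obj Y) \<K>"
    using algebraD(2) coalgebraD(2) alg by blast+
  have "conv Y Y (f \<cdot> (lam X \<cdot> g)) (f \<cdot> g) = f \<cdot> conv Y X (lam X \<cdot> g) g"
    by (rule conv_postcomp[OF mor(1) alg(4,1,2) lg Homs(2), symmetric])
  also have "\<dots> = f \<cdot> (eta X \<cdot> eps Y)"
    unfolding conv_antipode_coalg_mor[OF mor(4) alg(4) hopf(1)] ..
  also have "\<dots> = eta Y \<cdot> eps Y"
    using Comp_assoc[OF eta(2,1) Homs(1)] mor(1) by (simp add: alg_mor_def)
  finally have e: "conv Y Y (f \<cdot> lam X \<cdot> g) (f \<cdot> g) = eta Y \<cdot> eps Y"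
    using Comp_assoc[OF Homs(2,5,1)] by simp
  show ?thesis
    unfolding q_conv by (rule conv_cancel_right[OF alg(4,2) Id_Hom[OF ob(2)] h e])
qed

lemma conv_q_ap:
  assumes fit: "fits C n [obj Y] s" "m = n + 1"
  shows "apmu Y n (ap1 m (obj X) f (obj Y) (ap1 m (obj Y) g (obj X) (ap1 n (obj Y) q (obj Y)
      (apdelta Y n s)))) = s"
proof -
  have "run C n [(0, [obj Y], delta Y, [obj Y, obj Y]), (0, [obj Y], q, [obj Y]), (1, [obj Y], g,
      [obj X]), (1, [obj X], f, [obj Y]),
     (0, [obj Y, obj Y], mu Y, [obj Y])] s = run C n [] s"
    by (rule diagram_rule[OF conv_q[unfolded conv_def]], (rule diag_intros fit | simp)+)
  then show ?thesis using fit by simp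
qed

text \<open>
  Both sides, multiplied on the right by \<open>f \<mu>_X (g \<otimes> X)\<close> in the convolution algebra of arrows from
  \<open>Y \<otimes> X\<close> to \<open>Y\<close>, become \<open>\<mu>_Y (Y \<otimes> f)\<close>, and this factor is invertible.
\<close>

lemma q_mu_f: "q \<cdot> (mu Y \<cdot> (\<I> (obj Y) \<otimes> f)) = q \<otimes> eps X"
proof -
  let ?P = "tensor_ac C Y X"
  let ?k = "mu Y \<cdot> (\<I> (obj Y) \<otimes> f)" and ?j = "mu X \<cdot> (g \<otimes> \<I> (obj X))"
  have P: "coalgebra C ?P" by (rule coalgebra_tensor[OF alg(4,3)])
  have kH: "?k \<in> Hom C (obj ?P) (obj Y)" and jH: "?j \<in> Hom C (obj ?P) (obj X)"
    and qe: "q \<otimes> eps X \<in> Hom C (obj ?P) (obj Y)"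
    by (rule denotes_Hom, (rule diag_intros | simp only: append.simps)+, simp, simp)+
  have k: "coalg_mor C ?P Y ?k"
    unfolding coalg_mor_def
    by (intro conjI, rule kH, unfold tensor_ac_sel)
      (rule diagram_eqI, ((rule diag_intros | simp only: append.simps)+)[3], simp add: diag_rules
          braids_first del: One_nat_def layer_left_first)+
  have j: "coalg_mor C ?P X ?j"
    unfolding coalg_mor_def
    by (intro conjI, rule jH, unfold tensor_ac_sel)
      (rule diagram_eqI, ((rule diag_intros | simp only: append.simps)+)[3], simp add: diag_rules
          braids_first del: One_nat_def layer_left_first)+
  have gk: "g \<cdot> ?k = ?j"
    by (rule diagram_eqI, ((rule diag_intros | simp only: append.simps)+)[3],
        simp add: diag_rules del: One_nat_def)
  have uH: "f \<cdot> ?j \<in> Hom C (obj ?P) (obj Y)" "lam X \<cdot> ?j \<in> Hom C (obj ?P) (obj X)"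
      "f \<cdot> (lam X \<cdot> ?j) \<in> Hom C (obj ?P) (obj Y)" "f \<cdot> lam X \<cdot> g \<in> Hom C (obj Y) (obj Y)"
    using Homs jH Comp_Hom by blast+
  have e: "eta X \<in> Hom C \<K> (obj X)" "eps ?P \<in> Hom C (obj ?P) \<K>"
    using algebraD(2)[OF alg(1)] coalgebraD(2)[OF P] by auto
  have inv: "conv ?P Y (f \<cdot> ?j) (f \<cdot> (lam X \<cdot> ?j)) = eta Y \<cdot> eps ?P"
  proof -
    have "conv ?P Y (f \<cdot> ?j) (f \<cdot> (lam X \<cdot> ?j)) = f \<cdot> conv ?P X ?j (lam X \<cdot> ?j)"
      by (rule conv_postcomp[OF mor(1) P alg(1,2) jH uH(2), symmetric])
    also have "\<dots> = f \<cdot> (eta X \<cdot> eps ?P)"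
      unfolding conv_coalg_mor_antipode[OF j P hopf(1)] ..
    also have "\<dots> = eta Y \<cdot> eps ?P"
      using Comp_assoc[OF e(2,1) Homs(1)] mor(1) unfolding alg_mor_def by metis
    finally show ?thesis .
  qed
  \<comment> \<open>In elements: q(y1) f(g(y2) x) = q(y1) f(g(y2)) f(x) = y f(x), by
    \<open>conv_q\<close>.\<close>
  have qk: "conv ?P Y (q \<otimes> eps X) (f \<cdot> ?j) = ?k"
    unfolding conv_def tensor_ac_sel
    by (rule diagram_eqI, ((rule diag_intros | simp only: append.simps)+)[3],
        simp add: diag_rules conv_q_ap del: One_nat_def)
  have "q \<cdot> ?k = conv ?P Y (\<I> (obj Y) \<cdot> ?k) ((f \<cdot> lam X \<cdot> g) \<cdot> ?k)"
    unfolding q_conv by (rule conv_precomp[OF k P alg(4,2) Id_Hom[OF ob(2)] uH(4)])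
  also have "(f \<cdot> lam X \<cdot> g) \<cdot> ?k = f \<cdot> (lam X \<cdot> ?j)"
    unfolding Comp_assoc[OF kH Homs(2) Comp_Hom[OF Homs(5,1)]] gk by (rule Comp_assoc[OF jH
        Homs(5,1)])
  also have "\<I> (obj Y) \<cdot> ?k = ?k" by (rule Id_Comp[OF kH])
  also have "conv ?P Y ?k (f \<cdot> (lam X \<cdot> ?j)) = q \<otimes> eps X"
    using conv_cancel_right[OF P alg(2) qe uH(1,3) inv] unfolding qk .
  finally show ?thesis .
qed

text \<open>
  The dual argument, in the convolution algebra of arrows from \<open>Y\<close> to \<open>Y \<otimes> X\<close>.
\<close>

lemma delta_q: "(\<I> (obj Y) \<otimes> g) \<cdot> delta Y \<cdot> q = q \<otimes> eta X"
proof -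
  let ?P = "tensor_ac C Y X"
  let ?k = "(\<I> (obj Y) \<otimes> g) \<cdot> delta Y"
  have P: "algebra C ?P" by (rule algebra_tensor[OF alg(2,1)])
  have kH: "?k \<in> Hom C (obj Y) (obj ?P)" and qe: "q \<otimes> eta X \<in> Hom C (obj Y) (obj ?P)"
    by (rule denotes_Hom, (rule diag_intros | simp only: append.simps)+, simp, simp)+
  have k: "alg_mor C Y ?P ?k"
    unfolding alg_mor_def
    by (intro conjI, rule kH, unfold tensor_ac_sel)
      (rule diagram_eqI, ((rule diag_intros | simp only: append.simps)+)[3], simp add: diag_rules
          braids_first del: One_nat_def layer_left_first)+
  have H: "f \<cdot> g \<in> Hom C (obj Y) (obj Y)" "lam X \<cdot> g \<in> Hom C (obj Y) (obj X)"
      "f \<cdot> (lam X \<cdot> g) \<in> Hom C (obj Y) (obj Y)"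
    using Homs Comp_Hom by blast+
  have e: "eta X \<in> Hom C \<K> (obj X)" "eps Y \<in> Hom C (obj Y) \<K>"
    using algebraD(2)[OF alg(1)] coalgebraD(2)[OF alg(4)] by auto
  have kf: "alg_mor C X ?P (?k \<cdot> f)"
    using alg_mor_Comp[OF mor(1) k alg(1,2) P] .
  have kfH: "?k \<cdot> f \<in> Hom C (obj X) (obj ?P)" using kf by (simp add: alg_mor_def)
  have inv: "conv Y ?P (?k \<cdot> f \<cdot> g) (?k \<cdot> f \<cdot> (lam X \<cdot> g)) = eta ?P \<cdot> eps Y"
  proof -
    have "conv Y ?P (?k \<cdot> f \<cdot> g) (?k \<cdot> f \<cdot> (lam X \<cdot> g)) = ?k \<cdot> f \<cdot> conv Y X g (lam X \<cdot> g)"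
      by (rule conv_postcomp[OF kf alg(4,1) P Homs(2) H(2), symmetric])
    also have "\<dots> = ?k \<cdot> f \<cdot> (eta X \<cdot> eps Y)"
      unfolding conv_coalg_mor_antipode[OF mor(4) alg(4) hopf(1)] ..
    also have "\<dots> = eta ?P \<cdot> eps Y"
      using Comp_assoc[OF e(2,1) kfH] kf unfolding alg_mor_def by metis
    finally show ?thesis .
  qed
  have qk: "conv Y ?P (q \<otimes> eta X) (?k \<cdot> f \<cdot> g) = ?k"
  proof -
    let ?s = "apdelta Y 0 (start C [obj Y])"
    \<comment> \<open>As a rewrite rule, coassociativity would turn the iterated coproduct into its
      right-nested form, which \<open>conv_q_ap\<close> does not match. So it is applied to the
      left-nested form beforehand.\<close>
    have "ap1 1 (obj Y) g (obj X) (apmu Y 0 (ap1 1 (obj X) f (obj Y) (ap1 1 (obj Y) g (obj X)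
        (ap1 0 (obj Y) q (obj Y) (apdelta Y 0 ?s))))) = ap1 1 (obj Y) g (obj X) ?s"
      by (subst conv_q_ap) (simp_all add: diag_rules del: One_nat_def)
    then show ?thesis
      unfolding conv_def tensor_ac_sel
      by - (rule diagram_eqI, ((rule diag_intros | simp only: append.simps)+)[3], simp add:
          diag_rules del: One_nat_def)
  qed
  have uH: "?k \<cdot> f \<cdot> g \<in> Hom C (obj Y) (obj ?P)" "?k \<cdot> f \<cdot> (lam X \<cdot> g) \<in> Hom C (obj Y) (obj ?P)"
    using kfH Homs H Comp_Hom by blast+
  have "?k \<cdot> q = conv Y ?P (?k \<cdot> \<I> (obj Y)) (?k \<cdot> (f \<cdot> lam X \<cdot> g))"
    unfolding q_conv by (rule conv_postcomp[OF k alg(4,2) P Id_Hom[OF ob(2)]])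
      (use Homs Comp_Hom in blast)
  also have "?k \<cdot> (f \<cdot> lam X \<cdot> g) = ?k \<cdot> f \<cdot> (lam X \<cdot> g)"
    unfolding Comp_assoc[OF Homs(2,5,1)] by (rule Comp_assoc[OF H(2) Homs(1) kH, symmetric])
  also have "?k \<cdot> \<I> (obj Y) = ?k" by (rule Comp_Id[OF kH])
  also have "conv Y ?P ?k (?k \<cdot> f \<cdot> (lam X \<cdot> g)) = q \<otimes> eta X"
    using conv_cancel_right[OF alg(4) P qe uH inv] unfolding qk .
  finally show ?thesis .
qed

lemma q_i: "q \<cdot> i = i"
  using Comp_assoc[OF Homs(4,3,4)] unfolding pi Comp_Id[OF Homs(4)] .

lemma p_q: "p \<cdot> q = p"
  using Comp_assoc[OF Homs(3,4,3)] unfolding pi Id_Comp[OF Homs(3)] by simp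

text \<open>Inherited from \<open>delta_q\<close> through \<open>q \<cdot> i = i\<close>. This is
  the equation that \<open>i\<close> satisfies as an equalizer, and it says without elements that
  \<open>I\<close> lies in the kernel of \<open>g\<close>.\<close>

lemma delta_i: "(\<I> (obj Y) \<otimes> g) \<cdot> delta Y \<cdot> i = i \<otimes> eta X"
proof -
  have "(\<I> (obj Y) \<otimes> g) \<cdot> delta Y \<cdot> i = (\<I> (obj Y) \<otimes> g) \<cdot> delta Y \<cdot> (q \<cdot> i)"
    by (simp only: q_i)
  also have "\<dots> = (\<I> (obj Y) \<otimes> g) \<cdot> delta Y \<cdot> q \<cdot> i"
    by (rule diagram_eqI, ((rule diag_intros | simp only: append.simps)+)[3], simp)
  also have "\<dots> = (q \<cdot> i) \<otimes> eta X"
    unfolding delta_q by (rule diagram_eqI, ((rule diag_intros | simp only: append.simps)+)[3],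
        simp add: diag_rules del: One_nat_def)
  finally show ?thesis unfolding q_i .
qed

text \<open>Since \<open>p = p \<cdot> q\<close>, the identity \<open>q_mu_f\<close> carries over:
  \<open>p\<close> is constant on cosets of the image of \<open>f\<close>.\<close>

lemma p_mu_f: "p \<cdot> (mu Y \<cdot> (\<I> (obj Y) \<otimes> f)) = p \<cdot> (\<I> (obj Y) \<otimes> eps X)"
proof -
  have "p \<cdot> (mu Y \<cdot> (\<I> (obj Y) \<otimes> f)) = (p \<cdot> q) \<cdot> (mu Y \<cdot> (\<I> (obj Y) \<otimes> f))"
    by (simp only: p_q)
  also have "\<dots> = p \<cdot> (q \<cdot> (mu Y \<cdot> (\<I> (obj Y) \<otimes> f)))"
    by (rule diagram_eqI, ((rule diag_intros | simp only: append.simps)+)[3], simp)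
  also have "\<dots> = (p \<cdot> q) \<cdot> (\<I> (obj Y) \<otimes> eps X)"
    unfolding q_mu_f
    by (rule diagram_eqI, ((rule diag_intros | simp only: append.simps)+)[3],
        simp add: diag_rules del: One_nat_def)
  finally show ?thesis unfolding p_q .
qed

lemma p_mu_f_ap:
  assumes fit: "fits C n [obj Y, obj X] s" "m = n + 1"
  shows "ap1 n (obj Y) p I (apmu Y n (ap1 m (obj X) f (obj Y) s)) = ap1 n (obj Y) p I (apeps X m s)"
proof -
  have "run C n [(1, [obj X], f, [obj Y]), (0, [obj Y, obj Y], mu Y, [obj Y]), (0, [obj Y], p,
      [I])] s =
     run C n [(1, [obj X], eps X, []), (0, [obj Y], p, [I])] s"
    by (rule diagram_rule[OF p_mu_f], (rule diag_intros fit | simp)+)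
  then show ?thesis using fit by simp
qed

text \<open>q(y) differs from y only by a right factor in the image of \<open>f\<close>, and
  \<open>p\<close> discards such a factor by \<open>p_mu_f\<close>.\<close>

lemma p_mu_q: "p \<cdot> mu Y \<cdot> (f \<otimes> q) = p \<cdot> mu Y \<cdot> (f \<otimes> \<I> (obj Y))"
  unfolding q_def proj_idem_def
  by (rule diagram_eqI, ((rule diag_intros | simp only: append.simps)+)[3],
      simp add: diag_rules p_mu_f_ap del: One_nat_def)

text \<open>Instantiated twice: at the projection of \<open>A\<close> onto \<open>H\<close> for the
  action of \<open>H\<close> on \<open>IA\<close>, and at that of \<open>D\<close> onto
  \<open>B\<close> for the action of \<open>B\<close> on \<open>ID\<close>.\<close>

lemma left_module_I: "left_module C X I (p \<cdot> mu Y \<cdot> (f \<otimes> i))"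
proof -
  let ?\<phi> = "p \<cdot> mu Y \<cdot> (f \<otimes> i)" and ?m = "\<I> (obj X) \<otimes> (mu Y \<cdot> (f \<otimes> i))"
  have "?\<phi> \<in> Hom C (obj X \<odot> I) I"
    by (rule denotes_Hom, (rule diag_intros | simp only: append.simps)+, simp, simp)
  moreover have "?\<phi> \<cdot> (eta X \<otimes> \<I> I) = \<I> I"
    by (rule diagram_eqI, ((rule diag_intros | simp only: append.simps)+)[3],
        simp add: diag_rules del: One_nat_def)
  moreover have "?\<phi> \<cdot> (\<I> (obj X) \<otimes> ?\<phi>) = p \<cdot> mu Y \<cdot> (f \<otimes> q) \<cdot> ?m"
    by (rule diagram_eqI, ((rule diag_intros | simp only: append.simps)+)[3],
        simp add: diag_rules del: One_nat_def)
  moreover have "p \<cdot> mu Y \<cdot> (f \<otimes> q) \<cdot> ?m = ?\<phi> \<cdot> (mu X \<otimes> \<I> I)"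
    unfolding p_mu_q
    by (rule diagram_eqI, ((rule diag_intros | simp only: append.simps)+)[3],
        simp add: diag_rules del: One_nat_def)
  ultimately show ?thesis using ob unfolding left_module_def by simp
qed

end

section \<open>Relative Rota-Baxter operators\<close>

locale rel_rota_baxter_op = strict_braided_category +
  fixes A D :: "('a, 'b) hopf" and L \<phi> :: 'b
  assumes rrb: "rel_rota_baxter C A D L \<phi>"
begin

abbreviation "bA \<equiv> bar C A D L \<phi>"

definition "mubar = mu A \<cdot> (\<I> (obj A) \<otimes> (\<phi> \<cdot> (L \<otimes> \<I> (obj A)))) \<cdot> (delta A \<otimes> \<I> (obj A))"
definition "lambar = \<phi> \<cdot> ((lam D \<cdot> L) \<otimes> lam A) \<cdot> delta A"

lemma bar_sel: "mu bA = mubar" "lam bA = lambar" "obj bA = obj A" "delta bA = delta A"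
  by (simp_all add: bar_def mubar_def lambar_def)

lemma hopf: "hopf_algebra C A" "hopf_algebra C D" and L: "coalg_mor C A D L"
  and mac: "module_alg_coalg C D A \<phi>"
  and RB: "mu D \<cdot> (L \<otimes> L) = L \<cdot> mu A \<cdot> (\<I> (obj A) \<otimes> (\<phi> \<cdot> (L \<otimes> \<I> (obj A)))) \<cdot> (delta A \<otimes> \<I> (obj A))"
  using rrb unfolding rel_rota_baxter_def by blast+

lemma alg: "algebra C A" "algebra C D" "coalgebra C A" "coalgebra C D"
  using hopf by auto

lemma ob: "obj A \<in> Ob C" "obj D \<in> Ob C"
  using algebraD(1) alg by auto

lemma act: "\<phi> \<in> Hom C (obj D \<odot> obj A) (obj A)"
    "\<phi> \<cdot> (eta D \<otimes> \<I> (obj A)) = \<I> (obj A)"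
    "\<phi> \<cdot> (\<I> (obj D) \<otimes> \<phi>) = \<phi> \<cdot> (mu D \<otimes> \<I> (obj A))"
    "\<phi> \<cdot> (\<I> (obj D) \<otimes> eta A) = eps D \<otimes> eta A"
    "\<phi> \<cdot> (\<I> (obj D) \<otimes> mu A) = mu A \<cdot> (\<phi> \<otimes> \<phi>) \<cdot> (\<I> (obj D) \<otimes> \<c> (obj D) (obj A) \<otimes> \<I> (obj A))
         \<cdot> (delta D \<otimes> \<I> (obj A) \<otimes> \<I> (obj A))"
    "eps A \<cdot> \<phi> = eps D \<otimes> eps A"
    "delta A \<cdot> \<phi> = (\<phi> \<otimes> \<phi>) \<cdot> ((\<I> (obj D) \<otimes> \<c> (obj D) (obj A) \<otimes> \<I> (obj A)) \<cdot> (delta D \<otimes> delta A))"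
  using mac unfolding module_alg_coalg_def left_module_def coalg_mor_def tensor_ac_sel by blast+

lemma Homs: "L \<in> Hom C (obj A) (obj D)" "lam A \<in> Hom C (obj A) (obj A)" "lam D \<in> Hom C (obj D)
    (obj D)"
  using L hopf lam_Hom by (auto simp: coalg_mor_def)

lemma gen_act: "gen C [obj D, obj A] \<phi> [obj A]"
  using gen21[OF act(1) ob(2,1)] .

lemmas diag_intros = denotes_rules gen_algebra[OF alg(1), THEN denotes_gen] gen_algebra[OF alg(2),
    THEN denotes_gen] gen_coalgebra[OF alg(3), THEN denotes_gen]
   gen_coalgebra[OF alg(4), THEN denotes_gen] ob Homs[THEN gen11, THEN denotes_gen]
       gen_act[THEN denotes_gen] denotes_Braid

abbreviation "apact n s \<equiv> layer C n [obj D, obj A] \<phi> [obj A] s"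

lemma act_ap:
  shows "fits C n [obj A] s \<Longrightarrow> apact n (apeta D n s) = s"
   and "fits C n [obj D, obj D, obj A] s \<Longrightarrow> apact n (apmu D n s) = apact n (apact (n + 1) s)"
   and "fits C n [obj D] s \<Longrightarrow> m = n + 1 \<Longrightarrow> apact n (apeta A m s) = apeta A n (apeps D n s)"
   and "fits C n [obj D, obj A, obj A] s \<Longrightarrow> m = n + 1 \<Longrightarrow> apact n (apmu A m s) =
     apmu A n (apact (n + 1) (apact n (cr (n + 1) (obj D) (obj A) (apdelta D n s))))"
   and "fits C n [obj D, obj A] s \<Longrightarrow> apeps A n (apact n s) = apeps A n (apeps D n s)"
   and "fits C n [obj D, obj A] s \<Longrightarrow> apdelta A n (apact n s) =
     apact (n + 1) (apact n (cr (n + 1) (obj D) (obj A) (apdelta A (n + 2) (apdelta D n s))))"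
proof -
  let ?a = "\<lambda>i::nat. (i, [obj D, obj A], \<phi>, [obj A])"
  show "apact n (apeta D n s) = s" if fit: "fits C n [obj A] s"
  proof -
    have "run C n [(0, [], eta D, [obj D]), ?a 0] s = run C n [] s"
      by (rule diagram_rule[OF act(2)], (rule diag_intros fit | simp)+)
    then show ?thesis by simp
  qed
  show "apact n (apmu D n s) = apact n (apact (n + 1) s)" if fit: "fits C n [obj D, obj D, obj A] s"
  proof -
    have "run C n [(0, [obj D, obj D], mu D, [obj D]), ?a 0] s = run C n [?a 1, ?a 0] s"
      by (rule diagram_rule[OF act(3)[symmetric]], (rule diag_intros fit | simp)+)
    then show ?thesis by simp
  qed
  show "apact n (apeta A m s) = apeta A n (apeps D n s)" if fit: "fits C n [obj D] s" and "m = n +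
      1"
  proof -
    have "run C n [(1, [], eta A, [obj A]), ?a 0] s = run C n [(0, [obj D], eps D, []), (0, [],
        eta A, [obj A])] s"
      by (rule diagram_rule[OF act(4)], (rule diag_intros fit | simp)+)
    then show ?thesis using that by simp
  qed
  show "apact n (apmu A m s) =
     apmu A n (apact (n + 1) (apact n (cr (n + 1) (obj D) (obj A) (apdelta D n s))))"
    if fit: "fits C n [obj D, obj A, obj A] s" and "m = n + 1"
  proof -
    have "run C n [(1, [obj A, obj A], mu A, [obj A]), ?a 0] s =
       run C n [(0, [obj D], delta D, [obj D, obj D]), (1, [obj D, obj A], \<c> (obj D) (obj A),
           [obj A, obj D]),
         ?a 0, ?a 1, (0, [obj A, obj A], mu A, [obj A])] s"
      by (rule diagram_rule[OF act(5)], (rule diag_intros fit | simp)+)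
    then show ?thesis using that by simp
  qed
  show "apeps A n (apact n s) = apeps A n (apeps D n s)" if fit: "fits C n [obj D, obj A] s"
  proof -
    have "run C n [?a 0, (0, [obj A], eps A, [])] s = run C n [(0, [obj D], eps D, []), (0,
        [obj A], eps A, [])] s"
      by (rule diagram_rule[OF act(6)], (rule diag_intros fit | simp)+)
    then show ?thesis by simp
  qed
  show "apdelta A n (apact n s) =
     apact (n + 1) (apact n (cr (n + 1) (obj D) (obj A) (apdelta A (n + 2) (apdelta D n s))))"
    if fit: "fits C n [obj D, obj A] s"
  proof -
    have "run C n [?a 0, (0, [obj A], delta A, [obj A, obj A])] s =
       run C n [(0, [obj D], delta D, [obj D, obj D]), (2, [obj A], delta A, [obj A, obj A]),
         (1, [obj D, obj A], \<c> (obj D) (obj A), [obj A, obj D]), ?a 0, ?a 1] s"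
      by (rule diagram_rule[OF act(7)], (rule diag_intros fit | simp)+)
    then show ?thesis by (simp add: numeral_2_eq_2)
  qed
qed

lemmas diag_rules = diag_simps alg ob Homs[THEN gen11] gen_act coalgebra_ap[OF alg(3)]
    coalgebra_ap[OF alg(4)]
   algebra_ap[OF alg(1)] algebra_ap[OF alg(2)] hopf_ap[OF hopf(1)] hopf_ap[OF hopf(2)]
       lam_ap[OF hopf(1)] lam_ap[OF hopf(2)] hopf
   coalg_mor_ap[OF L alg(3,4)] act_ap

lemma mubar_Hom: "mubar \<in> Hom C (obj A \<odot> obj A) (obj A)" and lambar_Hom: "lambar \<in> Hom C (obj A)
    (obj A)"
  unfolding mubar_def lambar_def
  by (rule denotes_Hom, (rule diag_intros | simp only: append.simps)+, simp, simp)+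

lemma gen_mubar: "gen C [obj A, obj A] mubar [obj A]"
  using gen21[OF mubar_Hom ob(1,1)] .

lemma L_mubar: "L \<cdot> mubar = mu D \<cdot> (L \<otimes> L)"
  unfolding RB mubar_def
  by (rule diagram_eqI, ((rule diag_intros | simp only: append.simps)+)[3], simp)

text \<open>Split the first argument into legs a1, a2, a3, a4. The left side combines a1 with a3 and
  a2 with a4, the right side a1 with a2 and a3 with a4; cocommutativity exchanges the middle
  legs.\<close>

lemma delta_mubar:
  assumes "cocommutative C A"
  shows "delta A \<cdot> mubar = (mubar \<otimes> mubar) \<cdot> (\<I> (obj A) \<otimes> \<c> (obj A) (obj A) \<otimes> \<I> (obj A)) \<cdot>
      (delta A \<otimes> delta A)"
  unfolding mubar_def
  by (rule diagram_eqI, ((rule diag_intros | simp only: append.simps)+)[3],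
      simp add: diag_rules cocommutative_ap[OF assms alg(3)] cocommutative_ap'[OF assms alg(3)]
          cocommutative_ap''[OF _ _ assms alg(3)] braids_first del: One_nat_def layer_left_first)

lemma mubar_eta: "mubar \<cdot> (\<I> (obj A) \<otimes> eta A) = \<I> (obj A)"
  unfolding mubar_def
  by (rule diagram_eqI, ((rule diag_intros | simp only: append.simps)+)[3],
      simp add: diag_rules del: One_nat_def)

text \<open>
  \<open>L \<eta>\<close> is group-like and idempotent, hence the unit.
\<close>

lemma L_eta: "L \<cdot> eta A = eta D"
proof -
  let ?U = "unit_ac C" and ?e = "L \<cdot> eta A"
  have o: "obj ?U = \<K>" "eps ?U = \<I> \<K>" "delta ?U = \<I> \<K>" by (simp_all add: unit_ac_def)
  have eH: "?e \<in> Hom C \<K> (obj D)" using algebraD(2)[OF alg(1)] Homs Comp_Hom by blast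
  have lH: "lam D \<cdot> ?e \<in> Hom C \<K> (obj D)" using eH Homs Comp_Hom by blast
  have e: "coalg_mor C ?U D ?e"
    unfolding coalg_mor_def o
    by (intro conjI, rule eH) (rule diagram_eqI, ((rule diag_intros | simp
        only: append.simps)+)[3], simp add: diag_rules del: One_nat_def)+
  have inv: "conv ?U D ?e (lam D \<cdot> ?e) = eta D \<cdot> eps ?U"
    by (rule conv_coalg_mor_antipode[OF e coalgebra_unit hopf(2)])
  \<comment> \<open>From the unit object, convolution is multiplication of elements of
    \<open>D\<close>; it gives L(1) L(1) = L(1 * 1) = L(1).\<close>
  have "conv ?U D ?e ?e = mu D \<cdot> (L \<otimes> L) \<cdot> (eta A \<otimes> eta A)"
    unfolding conv_def o
    by (rule diagram_eqI, ((rule diag_intros | simp only: append.simps)+)[3],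
        simp add: diag_rules del: One_nat_def)
  also have "\<dots> = L \<cdot> (mubar \<cdot> (\<I> (obj A) \<otimes> eta A)) \<cdot> eta A"
    unfolding L_mubar[symmetric]
    by (rule diagram_eqI, ((rule diag_intros gen_mubar[THEN denotes_gen] | simp
        only: append.simps)+)[3],
        simp add: diag_rules gen_mubar del: One_nat_def)
  also have "\<dots> = ?e"
    unfolding mubar_eta Comp_Id[OF Homs(1)] ..
  finally have ee: "conv ?U D ?e ?e = ?e" .
  have "?e = conv ?U D (conv ?U D ?e ?e) (lam D \<cdot> ?e)"
    by (rule conv_cancel_right[OF coalgebra_unit alg(2) _ _ _ inv, symmetric]) (simp_all add: eH
        lH o)
  also have "\<dots> = eta D \<cdot> eps ?U" unfolding ee inv ..
  finally show ?thesis using algebraD(2)[OF alg(2)] Comp_Id by (simp add: o)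
qed

text \<open>The nested actions of L(a2) and lam(L(a3)) on lam(a4) merge into the action of L(a2)
  lam(L(a3)), which is trivial; what remains is a1 lam(a2).\<close>

lemma conv_mubar: "mubar \<cdot> (\<I> (obj A) \<otimes> lambar) \<cdot> delta A = eta A \<cdot> eps A"
proof -
  have "mubar \<cdot> (\<I> (obj A) \<otimes> lambar) \<cdot> delta A
    = mu A \<cdot> (\<I> (obj A) \<otimes> (\<phi> \<cdot> (\<I> (obj D) \<otimes> \<phi>)
      \<cdot> (L \<otimes> (lam D \<cdot> L) \<otimes> lam A) \<cdot> (\<I> (obj A) \<otimes> delta A) \<cdot> delta A)) \<cdot> delta A"
    unfolding mubar_def lambar_def
    by (rule diagram_eqI, ((rule diag_intros | simp only: append.simps)+)[3],
        simp add: diag_rules del: One_nat_def)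
  also have "\<dots> = mu A \<cdot> (\<I> (obj A) \<otimes> (\<phi> \<cdot> ((mu D \<cdot> (L \<otimes> (lam D \<cdot> L)) \<cdot> delta A) \<otimes> lam A) \<cdot>
      delta A)) \<cdot> delta A"
    unfolding act(3)
    by (rule diagram_eqI, ((rule diag_intros | simp only: append.simps)+)[3],
        simp add: diag_rules del: One_nat_def)
  also have "mu D \<cdot> (L \<otimes> (lam D \<cdot> L)) \<cdot> delta A = eta D \<cdot> eps A"
    using conv_coalg_mor_antipode[OF L alg(3) hopf(2)] unfolding conv_def .
  also have "mu A \<cdot> (\<I> (obj A) \<otimes> (\<phi> \<cdot> ((eta D \<cdot> eps A) \<otimes> lam A) \<cdot> delta A)) \<cdot> delta A = eta A \<cdot>
      eps A"
    by (rule diagram_eqI, ((rule diag_intros | simp only: append.simps)+)[3],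
        simp add: diag_rules del: One_nat_def)
  finally show ?thesis .
qed

text \<open>Applying \<open>L\<close> to \<open>conv_mubar\<close> makes
  \<open>L \<cdot> lambar\<close> a right convolution inverse of \<open>L\<close>, while
  \<open>lam D \<cdot> L\<close> is a left one because \<open>L\<close> is a coalgebra
  morphism.\<close>

lemma L_lambar: "L \<cdot> lambar = lam D \<cdot> L"
proof -
  have H: "lam D \<cdot> L \<in> Hom C (obj A) (obj D)" "L \<cdot> lambar \<in> Hom C (obj A) (obj D)"
    using Homs lambar_Hom Comp_Hom by blast+
  have e: "eta A \<in> Hom C \<K> (obj A)" "eps A \<in> Hom C (obj A) \<K>"
    using algebraD(2)[OF alg(1)] coalgebraD(2)[OF alg(3)] by auto
  note diag_intros = diag_intros gen_mubar[THEN denotes_gen] lambar_Hom[THEN gen11,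
      THEN denotes_gen]
  have "conv A D L (L \<cdot> lambar) = mu D \<cdot> (L \<otimes> L) \<cdot> (\<I> (obj A) \<otimes> lambar) \<cdot> delta A"
    unfolding conv_def
    by (rule diagram_eqI, ((rule diag_intros | simp only: append.simps)+)[3],
        simp add: diag_rules gen_mubar lambar_Hom[THEN gen11] del: One_nat_def)
  also have "\<dots> = L \<cdot> (mubar \<cdot> (\<I> (obj A) \<otimes> lambar) \<cdot> delta A)"
    unfolding L_mubar[symmetric]
    by (rule diagram_eqI, ((rule diag_intros | simp only: append.simps)+)[3], simp)
  also have "\<dots> = eta D \<cdot> eps A"
    unfolding conv_mubar Comp_assoc[OF e(2,1) Homs(1), symmetric] L_eta ..
  finally have 1: "conv A D L (L \<cdot> lambar) = eta D \<cdot> eps A" .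
  have "lam D \<cdot> L = conv A D (conv A D (lam D \<cdot> L) L) (L \<cdot> lambar)"
    by (rule conv_cancel_right[OF alg(3,2) H(1) Homs(1) H(2) 1, symmetric])
  also have "\<dots> = L \<cdot> lambar"
    unfolding conv_antipode_coalg_mor[OF L alg(3) hopf(2)] by (rule conv_unit(2)[OF alg(3,2) H(2)])
  finally show ?thesis by simp
qed

end

section \<open>Strong projections\<close>

locale strong_rrb_proj = HA: hopf_proj C H A f g IA pA iA + BD: hopf_proj C B D h l ID pD iD +
  R: rel_rota_baxter_op C A D L \<phi>A + S: rel_rota_baxter_op C H B T \<phi>H
  for C (structure) and H A B D :: "('a, 'b) hopf" and f g h l :: 'b and IA ID :: 'a
    and pA iA pD iD L \<phi>A T \<phi>H :: 'b +
  assumes cocA: "cocommutative C A"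
    and Lf: "L \<cdot> f = h \<cdot> T" and f_act: "f \<cdot> \<phi>H = \<phi>A \<cdot> (h \<otimes> f)"
    and Tg: "T \<cdot> g = l \<cdot> L" and g_act: "g \<cdot> \<phi>A = \<phi>H \<cdot> (l \<otimes> g)"
    and strong1: "pA \<cdot> \<phi>A = pA \<cdot> \<phi>A \<cdot> (\<I> (obj D) \<otimes> HA.q)"
    and strong2: "R.mubar \<cdot> (R.mubar \<otimes> R.lambar) \<cdot> (\<I> (obj A) \<otimes> \<c> (obj A) (obj A)) \<cdot> (delta A \<otimes>
        \<I> (obj A)) \<cdot> (f \<otimes> iA) =
       mu A \<cdot> (R.mubar \<otimes> lam A) \<cdot> (\<I> (obj A) \<otimes> \<c> (obj A) (obj A)) \<cdot> ((delta A \<cdot> f) \<otimes> iA)"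
begin

lemmas diag_intros = HA.diag_intros BD.diag_intros R.diag_intros S.diag_intros
    R.gen_mubar[THEN HA.denotes_gen] S.gen_mubar[THEN HA.denotes_gen]
  R.lambar_Hom[THEN HA.gen11, THEN HA.denotes_gen]

section \<open>The idempotents on products f(x) * m\<close>

lemma g_act_ap:
  assumes fit: "fits C n [obj D, obj A] s"
  shows "HA.ap1 n (obj A) g (obj H) (R.apact n s) =
    S.apact n (HA.ap1 (n + 1) (obj A) g (obj H) (HA.ap1 n (obj D) l (obj B) s))"
proof -
  have "run C n [(0, [obj D, obj A], \<phi>A, [obj A]), (0, [obj A], g, [obj H])] s
    = run C n [(0, [obj D], l, [obj B]), (1, [obj A], g, [obj H]), (0, [obj B, obj H], \<phi>H,
        [obj H])] s"
    by (rule HA.diagram_rule[OF g_act], (rule diag_intros fit | simp)+)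
  then show ?thesis by simp
qed

lemma Tg_ap:
  assumes fit: "fits C n [obj A] s"
  shows "HA.ap1 n (obj D) l (obj B) (HA.ap1 n (obj A) L (obj D) s) =
    HA.ap1 n (obj H) T (obj B) (HA.ap1 n (obj A) g (obj H) s)"
proof -
  have "run C n [(0, [obj A], L, [obj D]), (0, [obj D], l, [obj B])] s
    = run C n [(0, [obj A], g, [obj H]), (0, [obj H], T, [obj B])] s"
    by (rule HA.diagram_rule[OF Tg[symmetric]], (rule diag_intros fit | simp)+)
  then show ?thesis by simp
qed

text \<open>\<open>g\<close> respects every ingredient of the bar product: product, coproduct,
  action, and the operator through \<open>T \<cdot> g = l \<cdot> L\<close>.\<close>

lemma g_mubar: "g \<cdot> R.mubar = S.mubar \<cdot> (g \<otimes> g)"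
  unfolding R.mubar_def S.mubar_def
  by (rule HA.diagram_eqI, ((rule diag_intros | simp only: append.simps)+)[3],
      simp add: HA.diag_rules BD.diag_rules R.diag_rules S.diag_rules g_act_ap Tg_ap
          del: One_nat_def)

lemma S_mubar_eta_ap:
  assumes "m = n + 1" and fit: "fits C n [obj H] s"
  shows "layer C n [obj H, obj H] S.mubar [obj H] (HA.apeta H m s) = s"
proof -
  have "run C n [(1, [], eta H, [obj H]), (0, [obj H, obj H], S.mubar, [obj H])] s = run C n [] s"
    by (rule HA.diagram_rule[OF S.mubar_eta], (rule diag_intros fit | simp)+)
  then show ?thesis using assms(1) by simp
qed

text \<open>For z = f(x) * m, the coproduct is multiplicative for \<open>*\<close>, the second leg
  of m goes to the unit under \<open>g\<close> by \<open>delta_i\<close>, and g(f(x)) = x. So z1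
  \<otimes> g(z2) is f(x1) * m next to x2, where x2 has to cross m.\<close>

lemma delta_mubar_fi:
  "(\<I> (obj A) \<otimes> g) \<cdot> delta A \<cdot> R.mubar \<cdot> (f \<otimes> iA) =
    (R.mubar \<otimes> \<I> (obj H)) \<cdot> (f \<otimes> iA \<otimes> \<I> (obj H)) \<cdot> (\<I> (obj H) \<otimes> \<c> (obj H) IA) \<cdot> (delta H \<otimes> \<I> IA)"
proof -
  have "(\<I> (obj A) \<otimes> g) \<cdot> delta A \<cdot> R.mubar \<cdot> (f \<otimes> iA) = (\<I> (obj A) \<otimes> g) \<cdot> (delta A \<cdot> R.mubar) \<cdot>
      (f \<otimes> iA)"
    by (rule HA.diagram_eqI, ((rule diag_intros | simp only: append.simps)+)[3], simp)
  also have "\<dots> = (R.mubar \<otimes> (g \<cdot> R.mubar)) \<cdot> (\<I> (obj A) \<otimes> \<c> (obj A) (obj A) \<otimes> \<I> (obj A)) \<cdot>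
      ((delta A \<cdot> f) \<otimes> (delta A \<cdot> iA))"
    unfolding R.delta_mubar[OF cocA]
    by (rule HA.diagram_eqI, ((rule diag_intros | simp only: append.simps)+)[3],
        simp add: HA.diag_rules R.gen_mubar del: One_nat_def)
  also have "\<dots> = (R.mubar \<otimes> S.mubar) \<cdot> (\<I> (obj A) \<otimes> \<c> (obj H) (obj A) \<otimes> \<I> (obj H)) \<cdot>
      (\<I> (obj A) \<otimes> g \<otimes> \<I> (obj A) \<otimes> g) \<cdot> ((delta A \<cdot> f) \<otimes> (delta A \<cdot> iA))"
  proof -
    have "(R.mubar \<otimes> (g \<cdot> R.mubar)) \<cdot> (\<I> (obj A) \<otimes> \<c> (obj A) (obj A) \<otimes> \<I> (obj A)) =
      (R.mubar \<otimes> S.mubar) \<cdot> (\<I> (obj A) \<otimes> \<c> (obj H) (obj A) \<otimes> \<I> (obj H)) \<cdot> (\<I> (obj A) \<otimes> g \<otimes>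
          \<I> (obj A) \<otimes> g)"
      unfolding g_mubar
      by (rule HA.diagram_eqI, ((rule diag_intros | simp only: append.simps)+)[3],
          simp add: HA.diag_rules R.gen_mubar S.gen_mubar del: One_nat_def)
    then show ?thesis by simp
  qed
  also have "\<dots> = (R.mubar \<otimes> S.mubar) \<cdot> (\<I> (obj A) \<otimes> \<c> (obj H) (obj A) \<otimes> \<I> (obj H)) \<cdot>
      (((\<I> (obj A) \<otimes> g) \<cdot> delta A \<cdot> f) \<otimes> ((\<I> (obj A) \<otimes> g) \<cdot> delta A \<cdot> iA))"
    by (rule HA.diagram_eqI, ((rule diag_intros | simp only: append.simps)+)[3],
        simp add: HA.diag_rules R.gen_mubar S.gen_mubar del: One_nat_def)
  also have "\<dots> = (R.mubar \<otimes> \<I> (obj H)) \<cdot> (f \<otimes> iA \<otimes> \<I> (obj H)) \<cdot> (\<I> (obj H) \<otimes> \<c> (obj H) IA) \<cdot>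
      (delta H \<otimes> \<I> IA)"
    unfolding HA.delta_i
    by (rule HA.diagram_eqI, ((rule diag_intros | simp only: append.simps)+)[3],
        simp add: HA.diag_rules R.gen_mubar S.gen_mubar S_mubar_eta_ap del: One_nat_def)
  finally show ?thesis .
qed

lemma T_eta_ap:
  assumes "fits C n [] s"
  shows "HA.ap1 n (obj H) T (obj B) (HA.apeta H n s) = HA.apeta B n s"
proof -
  have "run C n [(0, [], eta H, [obj H]), (0, [obj H], T, [obj B])] s = run C n [(0, [], eta B,
      [obj B])] s"
    by (rule HA.diagram_rule[OF S.L_eta], (rule diag_intros assms | simp)+)
  then show ?thesis by simp
qed

lemma f_lam: "f \<cdot> lam H = lam A \<cdot> f" and h_lam: "h \<cdot> lam B = lam D \<cdot> h"
  using HA.hopf_mor_lam HA.hopf BD.hopf by blast+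

text \<open>By \<open>delta_mubar_fi\<close>, q(z) = z1 f(lam(g(z2))) = (f(x1) * m) lam(f(x2)),
  which is the right-hand side of the second strongness condition.\<close>

lemma q_mubar_fi:
  "HA.q \<cdot> R.mubar \<cdot> (f \<otimes> iA) =
    mu A \<cdot> (R.mubar \<otimes> lam A) \<cdot> (\<I> (obj A) \<otimes> \<c> (obj A) (obj A)) \<cdot> ((delta A \<cdot> f) \<otimes> iA)"
proof -
  have "HA.q \<cdot> R.mubar \<cdot> (f \<otimes> iA) = mu A \<cdot> (\<I> (obj A) \<otimes> (f \<cdot> lam H)) \<cdot> ((\<I> (obj A) \<otimes> g) \<cdot> delta A
      \<cdot> R.mubar \<cdot> (f \<otimes> iA))"
    unfolding HA.q_def proj_idem_def
    by (rule HA.diagram_eqI, ((rule diag_intros | simp only: append.simps)+)[3], simp)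
  also have "\<dots> = mu A \<cdot> (R.mubar \<otimes> lam A) \<cdot> (\<I> (obj A) \<otimes> \<c> (obj A) (obj A)) \<cdot> ((delta A \<cdot> f) \<otimes> iA)"
    unfolding delta_mubar_fi f_lam
    by (rule HA.diagram_eqI, ((rule diag_intros | simp only: append.simps)+)[3],
        simp add: HA.diag_rules R.gen_mubar del: One_nat_def)
  finally show ?thesis .
qed

lemma q_L_mubar_fi: "BD.q \<cdot> L \<cdot> R.mubar \<cdot> (f \<otimes> iA) = L \<cdot> HA.q \<cdot> R.mubar \<cdot> (f \<otimes> iA)"
proof -
  \<comment> \<open>h(lam(T(x))) is the inverse of L(f(x)) in \<open>D\<close>, and
    \<open>L_lambar\<close> writes it as \<open>L\<close> of the bar inverse of f(x).\<close>
  have "h \<cdot> lam B \<cdot> T = lam D \<cdot> (L \<cdot> f)"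
    unfolding h_lam Lf by (rule HA.diagram_eqI, ((rule diag_intros | simp
        only: append.simps)+)[3], simp)
  also have "\<dots> = L \<cdot> R.lambar \<cdot> f"
    unfolding R.L_lambar by (rule HA.diagram_eqI, ((rule diag_intros | simp
        only: append.simps)+)[3], simp)
  finally have hT: "h \<cdot> lam B \<cdot> T = L \<cdot> R.lambar \<cdot> f" .
  have "BD.q \<cdot> L \<cdot> R.mubar \<cdot> (f \<otimes> iA) =
      mu D \<cdot> (L \<otimes> (h \<cdot> lam B \<cdot> (l \<cdot> L))) \<cdot> delta A \<cdot> R.mubar \<cdot> (f \<otimes> iA)"
    unfolding BD.q_def proj_idem_def
    by (rule HA.diagram_eqI, ((rule diag_intros | simp only: append.simps)+)[3],
        simp add: HA.diag_rules R.gen_mubar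
       HA.coalg_mor_ap[OF R.L R.alg(3,4)] BD.ob R.Homs[THEN HA.gen11] BD.Homs[THEN HA.gen11]
           BD.alg del: One_nat_def)
  also have "\<dots> = mu D \<cdot> (L \<otimes> (h \<cdot> lam B \<cdot> T)) \<cdot> ((\<I> (obj A) \<otimes> g) \<cdot> delta A \<cdot> R.mubar \<cdot> (f \<otimes> iA))"
    unfolding Tg[symmetric]
    by (rule HA.diagram_eqI, ((rule diag_intros | simp only: append.simps)+)[3],
        simp add: HA.diag_rules R.gen_mubar
       BD.ob R.Homs[THEN HA.gen11] S.Homs[THEN HA.gen11] BD.Homs[THEN HA.gen11] BD.alg
           del: One_nat_def)
  also have "\<dots> = mu D \<cdot> (L \<otimes> L) \<cdot> (R.mubar \<otimes> R.lambar) \<cdot> (\<I> (obj A) \<otimes> \<c> (obj A) (obj A)) \<cdot>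
      (delta A \<otimes> \<I> (obj A)) \<cdot> (f \<otimes> iA)"
    unfolding delta_mubar_fi hT
    by (rule HA.diagram_eqI, ((rule diag_intros | simp only: append.simps)+)[3],
        simp add: HA.diag_rules R.gen_mubar
       R.lambar_Hom[THEN HA.gen11] BD.ob R.Homs[THEN HA.gen11] S.Homs[THEN HA.gen11]
           BD.Homs[THEN HA.gen11] BD.alg del: One_nat_def)
  also have "\<dots> = L \<cdot> (R.mubar \<cdot> (R.mubar \<otimes> R.lambar) \<cdot> (\<I> (obj A) \<otimes> \<c> (obj A) (obj A)) \<cdot> (delta A
      \<otimes> \<I> (obj A)) \<cdot> (f \<otimes> iA))"
    unfolding R.L_mubar[symmetric]
    by (rule HA.diagram_eqI, ((rule diag_intros | simp only: append.simps)+)[3], simp)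
  \<comment> \<open>The second strongness condition, with \<open>q_mubar_fi\<close> identifying its
    right-hand side.\<close>
  also have "\<dots> = L \<cdot> (HA.q \<cdot> R.mubar \<cdot> (f \<otimes> iA))"
    unfolding strong2 q_mubar_fi ..
  also have "\<dots> = L \<cdot> HA.q \<cdot> R.mubar \<cdot> (f \<otimes> iA)"
    by (rule HA.diagram_eqI, ((rule diag_intros | simp only: append.simps)+)[3], simp)
  finally show ?thesis .
qed

section \<open>The three actions and the module axioms\<close>

abbreviation "psiM \<equiv> pA \<cdot> mu A \<cdot> (f \<otimes> iA)"
abbreviation "phiM \<equiv> pA \<cdot> \<phi>A \<cdot> (h \<otimes> iA)"
abbreviation "psiN \<equiv> pD \<cdot> mu D \<cdot> (h \<otimes> iD)"

lemma left_module_phiM: "left_module C B IA phiM"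
proof -
  have "phiM \<in> Hom C (obj B \<odot> IA) IA"
    by (rule HA.denotes_Hom, (rule diag_intros | simp only: append.simps)+, simp, simp)
  moreover have "phiM \<cdot> (eta B \<otimes> \<I> IA) = \<I> IA"
    by (rule HA.diagram_eqI, ((rule diag_intros | simp only: append.simps)+)[3],
        simp add: HA.diag_rules BD.diag_rules R.diag_rules del: One_nat_def)
  moreover have "phiM \<cdot> (\<I> (obj B) \<otimes> phiM) = phiM \<cdot> (mu B \<otimes> \<I> IA)"
  proof -
    \<comment> \<open>The inner \<open>iA \<cdot> pA\<close> is \<open>HA.q\<close>, placed where
      \<open>strong1\<close> removes it.\<close>
    have "phiM \<cdot> (\<I> (obj B) \<otimes> phiM) = (pA \<cdot> \<phi>A \<cdot> (\<I> (obj D) \<otimes> HA.q)) \<cdot> (h \<otimes> (\<phi>A \<cdot> (h \<otimes> iA)))"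
      by (rule HA.diagram_eqI, ((rule diag_intros | simp only: append.simps)+)[3],
          simp add: HA.diag_rules BD.diag_rules R.diag_rules del: One_nat_def)
    also have "\<dots> = pA \<cdot> (\<phi>A \<cdot> (\<I> (obj D) \<otimes> \<phi>A)) \<cdot> (h \<otimes> h \<otimes> iA)"
      unfolding strong1[symmetric]
      by (rule HA.diagram_eqI, ((rule diag_intros | simp only: append.simps)+)[3],
          simp add: HA.diag_rules BD.ob BD.Homs[THEN HA.gen11] R.gen_act del: One_nat_def)
    also have "\<dots> = phiM \<cdot> (mu B \<otimes> \<I> IA)"
      unfolding R.act(3)
      by (rule HA.diagram_eqI, ((rule diag_intros | simp only: append.simps)+)[3],
          simp add: HA.diag_rules BD.diag_rules R.diag_rules del: One_nat_def)
    finally show ?thesis .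
  qed
  ultimately show ?thesis using HA.ob(3) unfolding left_module_def by blast
qed

lemma phiM_psiM:
  "phiM \<cdot> (\<I> (obj B) \<otimes> psiM) =
    psiM \<cdot> (\<phi>H \<otimes> phiM) \<cdot> (\<I> (obj B) \<otimes> \<c> (obj B) (obj H) \<otimes> \<I> IA) \<cdot> (delta B \<otimes> \<I> (obj H) \<otimes> \<I> IA)"
proof -
  let ?cr = "(\<I> (obj B) \<otimes> \<c> (obj B) (obj H) \<otimes> \<I> IA) \<cdot> (delta B \<otimes> \<I> (obj H) \<otimes> \<I> IA)"
  have "phiM \<cdot> (\<I> (obj B) \<otimes> psiM) = (pA \<cdot> \<phi>A \<cdot> (\<I> (obj D) \<otimes> HA.q)) \<cdot> (h \<otimes> (mu A \<cdot> (f \<otimes> iA)))"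
    by (rule HA.diagram_eqI, ((rule diag_intros | simp only: append.simps)+)[3],
        simp add: HA.diag_rules BD.diag_rules R.diag_rules del: One_nat_def)
  also have "\<dots> = pA \<cdot> mu A \<cdot> ((\<phi>A \<cdot> (h \<otimes> f)) \<otimes> (\<phi>A \<cdot> (h \<otimes> iA))) \<cdot> ?cr"
    unfolding strong1[symmetric]
    by (rule HA.diagram_eqI, ((rule diag_intros | simp only: append.simps)+)[3],
        simp add: HA.diag_rules BD.diag_rules R.diag_rules del: One_nat_def)
  also have "\<dots> = (pA \<cdot> mu A \<cdot> (f \<otimes> \<I> (obj A))) \<cdot> (\<phi>H \<otimes> (\<phi>A \<cdot> (h \<otimes> iA))) \<cdot> ?cr"
    unfolding f_act[symmetric]
    by (rule HA.diagram_eqI, ((rule diag_intros | simp only: append.simps)+)[3],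
        simp add: HA.diag_rules BD.diag_rules R.diag_rules S.diag_rules del: One_nat_def)
  \<comment> \<open>Read backwards, \<open>p_mu_q\<close> inserts
    \<open>HA.q = iA \<cdot> pA\<close>: its \<open>pA\<close> completes \<open>phiM\<close> and its
    \<open>iA\<close> completes \<open>psiM\<close>.\<close>
  also have "\<dots> = psiM \<cdot> (\<phi>H \<otimes> phiM) \<cdot> ?cr"
    unfolding HA.p_mu_q[symmetric]
    by (rule HA.diagram_eqI, ((rule diag_intros | simp only: append.simps)+)[3],
        simp add: HA.diag_rules BD.diag_rules R.diag_rules S.diag_rules del: One_nat_def)
  also have "\<dots> = psiM \<cdot> (\<phi>H \<otimes> phiM) \<cdot> (\<I> (obj B) \<otimes> \<c> (obj B) (obj H) \<otimes> \<I> IA) \<cdot> (delta B \<otimes>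
      \<I> (obj H) \<otimes> \<I> IA)"
    by (rule HA.diagram_eqI, ((rule diag_intros | simp only: append.simps)+)[3], simp)
  finally show ?thesis .
qed

lemma iD_mono:
  assumes "u \<in> Hom C a ID" "v \<in> Hom C a ID" "iD \<cdot> u = iD \<cdot> v" shows "u = v"
  using HA.Comp_assoc[OF assms(1) BD.Homs(4,3)] HA.Comp_assoc[OF assms(2) BD.Homs(4,3)] assms
      BD.pi(2) HA.Id_Comp
  by metis

text \<open>In q(L(m)) = L(m1) h(lam(T(g(m2)))) the leg g(m2) is trivial by \<open>delta_i\<close>,
  and \<open>T\<close> preserves units. Hence \<open>L\<close> maps the kernel of \<open>g\<close>
  to that of \<open>l\<close>.\<close>

lemma q_L_iA: "BD.q \<cdot> L \<cdot> iA = L \<cdot> iA"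
proof -
  have "BD.q \<cdot> L \<cdot> iA = mu D \<cdot> (L \<otimes> (h \<cdot> lam B \<cdot> (l \<cdot> L))) \<cdot> delta A \<cdot> iA"
    unfolding BD.q_def proj_idem_def
    by (rule HA.diagram_eqI, ((rule diag_intros | simp only: append.simps)+)[3],
        simp add: HA.diag_rules
       HA.coalg_mor_ap[OF R.L R.alg(3,4)] BD.ob R.Homs[THEN HA.gen11] BD.Homs[THEN HA.gen11]
           BD.alg del: One_nat_def)
  also have "\<dots> = mu D \<cdot> (L \<otimes> (h \<cdot> lam B \<cdot> T)) \<cdot> ((\<I> (obj A) \<otimes> g) \<cdot> delta A \<cdot> iA)"
    unfolding Tg[symmetric]
    by (rule HA.diagram_eqI, ((rule diag_intros | simp only: append.simps)+)[3],
        simp add: HA.diag_rules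
       BD.ob R.Homs[THEN HA.gen11] S.Homs[THEN HA.gen11] BD.Homs[THEN HA.gen11] BD.alg
           del: One_nat_def)
  also have "\<dots> = L \<cdot> iA"
    unfolding HA.delta_i
    by (rule HA.diagram_eqI, ((rule diag_intros | simp only: append.simps)+)[3],
        simp add: HA.diag_rules BD.diag_rules
       R.Homs[THEN HA.gen11] S.Homs[THEN HA.gen11] T_eta_ap del: One_nat_def)
  finally show ?thesis .
qed

text \<open>The witness is forced: compose \<open>iD \<cdot> L0 = L \<cdot> iA\<close> with
  \<open>pD\<close>.\<close>

lemma L0_exists: "pD \<cdot> L \<cdot> iA \<in> Hom C IA ID" "iD \<cdot> (pD \<cdot> L \<cdot> iA) = L \<cdot> iA"
proof -
  show "pD \<cdot> L \<cdot> iA \<in> Hom C IA ID"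
    by (rule HA.denotes_Hom, (rule diag_intros | simp only: append.simps)+, simp, simp)
  have "iD \<cdot> (pD \<cdot> L \<cdot> iA) = (iD \<cdot> pD) \<cdot> L \<cdot> iA"
    by (rule HA.diagram_eqI, ((rule diag_intros | simp only: append.simps)+)[3], simp)
  then show "iD \<cdot> (pD \<cdot> L \<cdot> iA) = L \<cdot> iA"
    unfolding BD.pi(1) q_L_iA .
qed

lemma intertwining:
  assumes G: "\<gamma> \<in> Hom C IA ID" "iD \<cdot> \<gamma> = L \<cdot> iA"
  shows "psiN \<cdot> (T \<otimes> \<gamma>) = \<gamma> \<cdot> psiM \<cdot> (\<I> (obj H) \<otimes> (phiM \<cdot> (T \<otimes> \<I> IA))) \<cdot> (delta H \<otimes> \<I> IA)"
proof (rule iD_mono)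
  note diag_intros = diag_intros G(1)[THEN HA.gen11, THEN HA.denotes_gen]
  let ?R = "\<gamma> \<cdot> psiM \<cdot> (\<I> (obj H) \<otimes> (phiM \<cdot> (T \<otimes> \<I> IA))) \<cdot> (delta H \<otimes> \<I> IA)"
  show "psiN \<cdot> (T \<otimes> \<gamma>) \<in> Hom C (obj H \<odot> IA) ID" "?R \<in> Hom C (obj H \<odot> IA) ID"
    by (rule HA.denotes_Hom, (rule diag_intros | simp only: append.simps)+, simp, simp)+
  \<comment> \<open>Composition with \<open>iD\<close> turns \<open>pD\<close> into
    \<open>BD.q\<close> and \<open>\<gamma>\<close> into \<open>L \<cdot> iA\<close>, so that the
    multiplicativity of \<open>L\<close> applies.\<close>
  have "iD \<cdot> (psiN \<cdot> (T \<otimes> \<gamma>)) = (iD \<cdot> pD) \<cdot> mu D \<cdot> ((h \<cdot> T) \<otimes> (iD \<cdot> \<gamma>))"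
    by (rule HA.diagram_eqI, ((rule diag_intros | simp only: append.simps)+)[3],
        simp add: HA.diag_rules BD.ob BD.alg R.Homs[THEN HA.gen11] S.Homs[THEN HA.gen11]
            BD.Homs[THEN HA.gen11] G(1)[THEN HA.gen11] del: One_nat_def)
  also have "\<dots> = BD.q \<cdot> (mu D \<cdot> (L \<otimes> L)) \<cdot> (f \<otimes> iA)"
    unfolding BD.pi(1) G(2) Lf[symmetric]
    by (rule HA.diagram_eqI, ((rule diag_intros | simp only: append.simps)+)[3],
        simp add: HA.diag_rules BD.ob BD.alg R.Homs[THEN HA.gen11] S.Homs[THEN HA.gen11]
            BD.Homs[THEN HA.gen11] G(1)[THEN HA.gen11] del: One_nat_def)
  also have "\<dots> = BD.q \<cdot> L \<cdot> R.mubar \<cdot> (f \<otimes> iA)"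
    unfolding R.L_mubar[symmetric]
    by (rule HA.diagram_eqI, ((rule diag_intros | simp only: append.simps)+)[3], simp)
  also have "\<dots> = L \<cdot> HA.q \<cdot> R.mubar \<cdot> (f \<otimes> iA)"
    by (rule q_L_mubar_fi)
  also have "\<dots> = L \<cdot> HA.q \<cdot> mu A \<cdot> (f \<otimes> \<I> (obj A)) \<cdot> (\<I> (obj H) \<otimes> (\<phi>A \<cdot> ((L \<cdot> f) \<otimes> iA))) \<cdot>
      (delta H \<otimes> \<I> IA)"
    unfolding R.mubar_def
    by (rule HA.diagram_eqI, ((rule diag_intros | simp only: append.simps)+)[3],
        simp add: HA.diag_rules BD.ob BD.alg R.Homs[THEN HA.gen11] R.gen_act del: One_nat_def)
  also have "\<dots> = (L \<cdot> iA) \<cdot> (pA \<cdot> mu A \<cdot> (f \<otimes> \<I> (obj A))) \<cdot> (\<I> (obj H) \<otimes> (\<phi>A \<cdot> ((h \<cdot> T) \<otimes> iA))) \<cdot>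
      (delta H \<otimes> \<I> IA)"
    unfolding HA.pi(1)[symmetric] Lf
    by (rule HA.diagram_eqI, ((rule diag_intros | simp only: append.simps)+)[3], simp)
  \<comment> \<open>As in \<open>phiM_psiM\<close>, \<open>p_mu_q\<close> is read backwards to
    supply the projection inside \<open>phiM\<close>; \<open>L \<cdot> iA\<close> is exchanged for
    \<open>iD \<cdot> \<gamma>\<close>.\<close>
  also have "\<dots> = iD \<cdot> ?R"
    unfolding HA.p_mu_q[symmetric] G(2)[symmetric] HA.pi(1)[symmetric]
    by (rule HA.diagram_eqI, ((rule diag_intros | simp only: append.simps)+)[3],
        simp add: HA.diag_rules BD.ob BD.alg R.Homs[THEN HA.gen11] S.Homs[THEN HA.gen11]
            BD.Homs[THEN HA.gen11] R.gen_act G(1)[THEN HA.gen11] del: One_nat_def)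
  finally show "iD \<cdot> (psiN \<cdot> (T \<otimes> \<gamma>)) = iD \<cdot> ?R" .
qed

lemma rrb_module_projection:
  assumes "\<gamma> \<in> Hom C IA ID" "iD \<cdot> \<gamma> = L \<cdot> iA"
  shows "rrb_module C H B T \<phi>H (IA, ID, psiM, phiM, psiN, \<gamma>)"
  unfolding rrb_module_def prod.case
  using HA.left_module_I BD.left_module_I left_module_phiM phiM_psiM intertwining[OF assms]
      assms(1) by blast

end

theorem theorem3p19:
  fixes C :: "('o, 'm) braided_cat" (structure)
    and H B A D :: "('o, 'm) hopf"
    and T L \<phi>H \<phi>A f h g l :: 'm
    and IA ID :: 'o
    and pA iA pD iD :: 'm
  assumes "split_strict_braided_category C"
    and "cocommutative C H" and "cocommutative C B"
    and "cocommutative C A" and "cocommutative C D"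
    and "splitting C (proj_idem C H A f g) (obj A) IA pA iA"
    and "splitting C (proj_idem C B D h l) (obj D) ID pD iD"
    and "strong_rrb_projection C H B T \<phi>H A D L \<phi>A f h g l pA iA"
  shows "(\<exists>!L0. L0 \<in> Hom C IA ID \<and> iD \<cdot> L0 = L \<cdot> iA) \<and>
    (\<forall>L0. L0 \<in> Hom C IA ID \<and> iD \<cdot> L0 = L \<cdot> iA \<longrightarrow>
      rrb_module C H B T \<phi>H
        (IA, ID,
         pA \<cdot> mu A \<cdot> (f \<otimes> iA),
         pA \<cdot> \<phi>A \<cdot> (h \<otimes> iA),
         pD \<cdot> mu D \<cdot> (h \<otimes> iD),
         L0))"
proof -
  interpret strict_braided_category C
    using assms(1) by (rule split_strict_braided_category.axioms(1))
  have proj: "hopf_projection C H A f g" "hopf_projection C B D h l"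
    and m: "rrb_mor C H B T \<phi>H A D L \<phi>A f h" "rrb_mor C A D L \<phi>A H B T \<phi>H g l"
    and s1: "pA \<cdot> \<phi>A = pA \<cdot> \<phi>A \<cdot> (\<I> (obj D) \<otimes> proj_idem C H A f g)"
    and s2: "adjoint_action C (bar C A D L \<phi>A) \<cdot> (f \<otimes> iA) =
       mu A \<cdot> (mu (bar C A D L \<phi>A) \<otimes> lam A) \<cdot> (\<I> (obj A) \<otimes> \<c> (obj A) (obj A)) \<cdot> ((delta A \<cdot> f) \<otimes>
           iA)"
    using assms(8) unfolding strong_rrb_projection_def rrb_projection_def by blast+
  interpret HA: hopf_proj C H A f g IA pA iA by unfold_locales (rule proj assms)+
  interpret BD: hopf_proj C B D h l ID pD iD by unfold_locales (rule proj assms)+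
  have rb: "rel_rota_baxter C A D L \<phi>A" "rel_rota_baxter C H B T \<phi>H"
    using m unfolding rrb_mor_def by blast+
  interpret R: rel_rota_baxter_op C A D L \<phi>A by unfold_locales (rule rb)
  interpret S: rel_rota_baxter_op C H B T \<phi>H by unfold_locales (rule rb)
  interpret strong_rrb_proj C H A B D f g h l IA ID pA iA pD iD L \<phi>A T \<phi>H
  proof unfold_locales
    show "R.mubar \<cdot> (R.mubar \<otimes> R.lambar) \<cdot> (\<I> (obj A) \<otimes> \<c> (obj A) (obj A)) \<cdot> (delta A \<otimes> \<I> (obj A))
        \<cdot> (f \<otimes> iA) =
       mu A \<cdot> (R.mubar \<otimes> lam A) \<cdot> (\<I> (obj A) \<otimes> \<c> (obj A) (obj A)) \<cdot> ((delta A \<cdot> f) \<otimes> iA)"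
      using s2 unfolding adjoint_action_def R.bar_sel .
  qed (use m s1 assms(4) in \<open>auto simp: rrb_mor_def HA.q_def\<close>)
  show ?thesis
    \<comment> \<open>Uniqueness holds because \<open>iD\<close> is a split monomorphism.\<close>
    using L0_exists iD_mono rrb_module_projection by metis
qed

end
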